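(* Let $G$ be a finite group acting faithfully on a finite set $M$, and let $H$ be an orbit-maximal subgroup of $G$. (a) After restriction to $G$ (the group of units of $\mathcal{FP}^+(G,M)$), the $G$-$\mathrm{N}_G(H)/H$-bimodule $V_H$ is isomorphic to the bimodule $\mathbb{C}[G/H]$. (b) Let $X$ be a simple (complex) $\mathrm{N}_G(H)/H$-module. Then, after restriction to $G$, the $\mathcal{FP}^+(G,M)$-module $L(H,X)$ becomes isomorphic to $\mathbb{C}[G/H]\otimes_{\mathrm{N}_G(H)/H}X$.
   Context: The factorpower $\mathcal{FP}^+(G,M)$ of a finite group $G$ acting (on the left) on a finite set $M$ is the finite monoid whose elements are the classes $\overline{A}$ of nonempty subsets $A\subset G$ under the congruence $A\sim_M B$ iff $\{a(m)\mid a\in A\}=\{b(m)\mid b\in B\}$ for all $m\in M$, with multiplication $\overline{A}\,\overline{B}=\overline{AB}$, where $AB=\{ab\mid a\in A,b\in B\}$. When the action is faithful, $G$ is identified with the group of units of $\mathcal{FP}^+(G,M)$ via $\tau\mapsto\overline{\{\tau\}}$. Two subgroups of $G$ are orbit-equivalent if they have the same orbits on $M$; a subgroup is orbit-maximal if it is the (unique) maximal element, with respect to inclusion, among all subgroups orbit-equivalent to it. For $H$ orbit-maximal, $\overline{H}$ is an idempotent and $X\mapsto\overline{X}$ identifies $\mathrm{N}_G(H)/H$ with the maximal subgroup ($\mathcal{H}$-class) of $\mathcal{FP}^+(G,M)$ with identity $\overline{H}$, where $\mathrm{N}_G(H)$ is the normalizer of $H$ in $G$. Let $\mathcal{L}_H$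 be the $\mathcal{L}$-class of $\overline{H}$ in $\mathcal{FP}^+(G,M)$, and let $V_H$ be the formal $\mathbb{C}$-span of $\mathcal{L}_H$ with the $\mathcal{FP}^+(G,M)$-$\mathrm{N}_G(H)/H$-bimodule structure given for $x\in\mathcal{L}_H$, $s\in\mathcal{FP}^+(G,M)$, $g\in\mathrm{N}_G(H)/H$ by $s\cdot x\cdot g=sxg$ if $sxg\in\mathcal{L}_H$, and $0$ otherwise. For a simple complex $\mathrm{N}_G(H)/H$-module $X$ put $L(H,X)=V_H\otimes_{\mathrm{N}_G(H)/H}X$ (tensor product over the group algebra); this is the simple $\mathcal{FP}^+(G,M)$-module associated with $H$ and $X$. The bimodule $\mathbb{C}[G/H]$ is the span of the left cosets $G/H$ with $G$ acting by left multiplication and $\mathrm{N}_G(H)/H$ acting by right multiplication. *)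

theory Defs
  imports
    Complex_Main
    "HOL-Library.Poly_Mapping"
    "HOL-Algebra.Group_Action"
    "HOL-Algebra.Left_Coset"
    "HOL-Algebra.AbelCoset"
    "HOL-Algebra.Module"
    "HOL-Algebra.Zassenhaus"
begin

section \<open>Factorpowers\<close>

definition factorpower_rel ::
    "('a, 'm) monoid_scheme \<Rightarrow> 'b set \<Rightarrow> ('a \<Rightarrow> 'b \<Rightarrow> 'b) \<Rightarrow> ('a set \<times> 'a set) set" where
  "factorpower_rel G M \<phi> = {(A, B). A \<noteq> {} \<and> A \<subseteq> carrier G \<and> B \<noteq> {} \<and> B \<subseteq> carrier G \<and>
     (\<forall>m\<in>M. {\<phi> a m | a. a \<in> A} = {\<phi> b m | b. b \<in> B})}"

definition factorpower_class ::
    "('a, 'm) monoid_scheme \<Rightarrow> 'b set \<Rightarrow> ('a \<Rightarrow> 'b \<Rightarrow> 'b) \<Rightarrow> 'a set \<Rightarrow> 'a set set" where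
  "factorpower_class G M \<phi> A = factorpower_rel G M \<phi> `` {A}"

text \<open>The product of two classes is the union of the classes of all products of representatives;
  these classes coincide because the relation is a congruence
  (\<open>factorpower_mult_class\<close> below).\<close>

definition factorpower ::
    "('a, 'm) monoid_scheme \<Rightarrow> 'b set \<Rightarrow> ('a \<Rightarrow> 'b \<Rightarrow> 'b) \<Rightarrow> 'a set set monoid" where
  "factorpower G M \<phi> =
    \<lparr>carrier = {A. A \<noteq> {} \<and> A \<subseteq> carrier G} // factorpower_rel G M \<phi>,
     mult = (\<lambda>X Y. \<Union>A\<in>X. \<Union>B\<in>Y. factorpower_class G M \<phi> (A <#>\<^bsub>G\<^esub> B)),
     one = factorpower_class G M \<phi> {\<one>\<^bsub>G\<^esub>}\<rparr>"

definition factorpower_unit ::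
    "('a, 'm) monoid_scheme \<Rightarrow> 'b set \<Rightarrow> ('a \<Rightarrow> 'b \<Rightarrow> 'b) \<Rightarrow> 'a \<Rightarrow> 'a set set" where
  "factorpower_unit G M \<phi> g = factorpower_class G M \<phi> {g}"

definition orbit_equivalent ::
    "('a, 'm) monoid_scheme \<Rightarrow> 'b set \<Rightarrow> ('a \<Rightarrow> 'b \<Rightarrow> 'b) \<Rightarrow> 'a set \<Rightarrow> 'a set \<Rightarrow> bool" where
  "orbit_equivalent G M \<phi> H K \<longleftrightarrow>
     orbits (G\<lparr>carrier := H\<rparr>) M \<phi> = orbits (G\<lparr>carrier := K\<rparr>) M \<phi>"

definition orbit_maximal ::
    "('a, 'm) monoid_scheme \<Rightarrow> 'b set \<Rightarrow> ('a \<Rightarrow> 'b \<Rightarrow> 'b) \<Rightarrow> 'a set \<Rightarrow> bool" where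
  "orbit_maximal G M \<phi> H \<longleftrightarrow> subgroup H G \<and>
     (\<forall>K. subgroup K G \<and> orbit_equivalent G M \<phi> H K \<and> H \<subseteq> K \<longrightarrow> K = H)"

definition normalizer_quotient :: "('a, 'm) monoid_scheme \<Rightarrow> 'a set \<Rightarrow> 'a set monoid" where
  "normalizer_quotient G H = (G\<lparr>carrier := normalizer G H\<rparr>) Mod H"

text \<open>Green's relation \<open>\<L>\<close> (equality of principal left ideals) in a monoid.\<close>

definition L_class :: "('s, 'm) monoid_scheme \<Rightarrow> 's \<Rightarrow> 's set" where
  "L_class S a = {b \<in> carrier S. {s \<otimes>\<^bsub>S\<^esub> b | s. s \<in> carrier S} = {s \<otimes>\<^bsub>S\<^esub> a | s. s \<in> carrier S}}"


section \<open>Complex modules and bimodules over monoids\<close>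

definition complex_ring :: "complex ring" where
  "complex_ring = \<lparr>carrier = UNIV, mult = (*), one = 1, zero = 0, add = (+)\<rparr>"

record ('s, 'v) left_mod = "(complex, 'v) module" +
  lact :: "'s \<Rightarrow> 'v \<Rightarrow> 'v"

record ('s, 'k, 'v) bimod = "('s, 'v) left_mod" +
  ract :: "'v \<Rightarrow> 'k \<Rightarrow> 'v"

text \<open>A module over the monoid algebra of \<open>S\<close>, given as a complex vector space with a unital
  linear action of \<open>S\<close>.\<close>

locale left_module = monoid S + V: module complex_ring V for S (structure) and V +
  assumes lact_closed: "\<lbrakk>s \<in> carrier S; v \<in> carrier V\<rbrakk> \<Longrightarrow> lact V s v \<in> carrier V"
    and lact_add: "\<lbrakk>s \<in> carrier S; v \<in> carrier V; w \<in> carrier V\<rbrakk> \<Longrightarrow>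
          lact V s (v \<oplus>\<^bsub>V\<^esub> w) = lact V s v \<oplus>\<^bsub>V\<^esub> lact V s w"
    and lact_smult: "\<lbrakk>s \<in> carrier S; v \<in> carrier V\<rbrakk> \<Longrightarrow>
          lact V s (c \<odot>\<^bsub>V\<^esub> v) = c \<odot>\<^bsub>V\<^esub> lact V s v"
    and lact_mult: "\<lbrakk>s \<in> carrier S; t \<in> carrier S; v \<in> carrier V\<rbrakk> \<Longrightarrow>
          lact V (s \<otimes> t) v = lact V s (lact V t v)"
    and lact_one: "v \<in> carrier V \<Longrightarrow> lact V \<one> v = v"

locale bimodule = left_module S V + K: monoid K for S (structure) and K and V +
  assumes ract_closed: "\<lbrakk>k \<in> carrier K; v \<in> carrier V\<rbrakk> \<Longrightarrow> ract V v k \<in> carrier V"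
    and ract_add: "\<lbrakk>k \<in> carrier K; v \<in> carrier V; w \<in> carrier V\<rbrakk> \<Longrightarrow>
          ract V (v \<oplus>\<^bsub>V\<^esub> w) k = ract V v k \<oplus>\<^bsub>V\<^esub> ract V w k"
    and ract_smult: "\<lbrakk>k \<in> carrier K; v \<in> carrier V\<rbrakk> \<Longrightarrow>
          ract V (c \<odot>\<^bsub>V\<^esub> v) k = c \<odot>\<^bsub>V\<^esub> ract V v k"
    and ract_mult: "\<lbrakk>j \<in> carrier K; k \<in> carrier K; v \<in> carrier V\<rbrakk> \<Longrightarrow>
          ract V v (j \<otimes>\<^bsub>K\<^esub> k) = ract V (ract V v j) k"
    and ract_one: "v \<in> carrier V \<Longrightarrow> ract V v \<one>\<^bsub>K\<^esub> = v"
    and lact_ract: "\<lbrakk>s \<in> carrier S; k \<in> carrier K; v \<in> carrier V\<rbrakk> \<Longrightarrow>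
          ract V (lact V s v) k = lact V s (ract V v k)"

locale simple_left_module = left_module +
  assumes nontrivial: "carrier V \<noteq> {\<zero>\<^bsub>V\<^esub>}"
    and simple: "\<lbrakk>submodule W complex_ring V; \<And>s v. \<lbrakk>s \<in> carrier S; v \<in> W\<rbrakk> \<Longrightarrow> lact V s v \<in> W\<rbrakk>
          \<Longrightarrow> W = {\<zero>\<^bsub>V\<^esub>} \<or> W = carrier V"

definition linear_iso ::
    "(complex, 'v, 'm) module_scheme \<Rightarrow> (complex, 'w, 'n) module_scheme \<Rightarrow> ('v \<Rightarrow> 'w) \<Rightarrow> bool" where
  "linear_iso V W f \<longleftrightarrow> bij_betw f (carrier V) (carrier W) \<and>
     (\<forall>v\<in>carrier V. \<forall>w\<in>carrier V. f (v \<oplus>\<^bsub>V\<^esub> w) = f v \<oplus>\<^bsub>W\<^esub> f w) \<and>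
     (\<forall>c. \<forall>v\<in>carrier V. f (c \<odot>\<^bsub>V\<^esub> v) = c \<odot>\<^bsub>W\<^esub> f v)"

definition left_module_isomorphic ::
    "('s, 'p) monoid_scheme \<Rightarrow> ('s, 'v, 'm) left_mod_scheme \<Rightarrow> ('s, 'w, 'n) left_mod_scheme \<Rightarrow> bool"
  where
  "left_module_isomorphic S V W \<longleftrightarrow> (\<exists>f. linear_iso V W f \<and>
     (\<forall>s\<in>carrier S. \<forall>v\<in>carrier V. f (lact V s v) = lact W s (f v)))"

definition bimodule_isomorphic ::
    "('s, 'p) monoid_scheme \<Rightarrow> ('k, 'q) monoid_scheme \<Rightarrow>
     ('s, 'k, 'v, 'm) bimod_scheme \<Rightarrow> ('s, 'k, 'w, 'n) bimod_scheme \<Rightarrow> bool" where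
  "bimodule_isomorphic S K V W \<longleftrightarrow> (\<exists>f. linear_iso V W f \<and>
     (\<forall>s\<in>carrier S. \<forall>v\<in>carrier V. f (lact V s v) = lact W s (f v)) \<and>
     (\<forall>k\<in>carrier K. \<forall>v\<in>carrier V. f (ract V v k) = ract W (f v) k))"

text \<open>Restriction of the left action along a map of monoids; any right action is kept as part of
  \<open>left_mod.more\<close>.\<close>

definition restrict_left ::
    "('t \<Rightarrow> 's) \<Rightarrow> ('s, 'v, 'm) left_mod_scheme \<Rightarrow> ('t, 'v, 'm) left_mod_scheme" where
  "restrict_left \<iota> V = \<lparr>carrier = carrier V, mult = mult V, one = one V, zero = zero V,
     add = add V, smult = smult V, lact = (\<lambda>t. lact V (\<iota> t)), \<dots> = left_mod.more V\<rparr>"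


section \<open>Formal complex spans\<close>

definition scale :: "complex \<Rightarrow> ('b \<Rightarrow>\<^sub>0 complex) \<Rightarrow> ('b \<Rightarrow>\<^sub>0 complex)" where
  "scale c f = Poly_Mapping.map (\<lambda>z. c * z) f"

definition linear_extend :: "('b \<Rightarrow> ('c \<Rightarrow>\<^sub>0 complex)) \<Rightarrow> ('b \<Rightarrow>\<^sub>0 complex) \<Rightarrow> ('c \<Rightarrow>\<^sub>0 complex)" where
  "linear_extend h f = (\<Sum>b\<in>Poly_Mapping.keys f. scale (Poly_Mapping.lookup f b) (h b))"

abbreviation basis :: "'b \<Rightarrow> ('b \<Rightarrow>\<^sub>0 complex)" where
  "basis b \<equiv> Poly_Mapping.single b 1"

text \<open>The ring fields \<open>mult\<close> and \<open>one\<close>, which every module record carries, play no role for vector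
  spaces.\<close>

definition formal_span :: "'b set \<Rightarrow> (complex, 'b \<Rightarrow>\<^sub>0 complex) module" where
  "formal_span B = \<lparr>carrier = {f. Poly_Mapping.keys f \<subseteq> B}, mult = undefined, one = undefined,
     zero = 0, add = (+), smult = scale\<rparr>"

definition span_bimod ::
    "'b set \<Rightarrow> ('s \<Rightarrow> 'b \<Rightarrow> ('b \<Rightarrow>\<^sub>0 complex)) \<Rightarrow> ('b \<Rightarrow> 'k \<Rightarrow> ('b \<Rightarrow>\<^sub>0 complex)) \<Rightarrow>
     ('s, 'k, 'b \<Rightarrow>\<^sub>0 complex) bimod" where
  "span_bimod B l r = \<lparr>carrier = carrier (formal_span B), mult = undefined, one = undefined,
     zero = \<zero>\<^bsub>formal_span B\<^esub>, add = add (formal_span B), smult = smult (formal_span B),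
     lact = (\<lambda>s. linear_extend (l s)), ract = (\<lambda>v k. linear_extend (\<lambda>b. r b k) v)\<rparr>"

text \<open>The two-sided action \<open>s \<cdot> x \<cdot> g\<close> on \<open>V\<^sub>H\<close>. The left and right actions of the bimodule arise by
  taking the other acting element to be the identity (which is \<open>H\<close> in the normalizer quotient).\<close>

definition VH_action ::
    "('a, 'm) monoid_scheme \<Rightarrow> 'b set \<Rightarrow> ('a \<Rightarrow> 'b \<Rightarrow> 'b) \<Rightarrow> 'a set \<Rightarrow>
     'a set set \<Rightarrow> 'a set set \<Rightarrow> 'a set \<Rightarrow> ('a set set \<Rightarrow>\<^sub>0 complex)" where
  "VH_action G M \<phi> H s x g =
     (let S = factorpower G M \<phi>; y = s \<otimes>\<^bsub>S\<^esub> x \<otimes>\<^bsub>S\<^esub> factorpower_class G M \<phi> g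
      in if y \<in> L_class S (factorpower_class G M \<phi> H) then basis y else 0)"

definition VH ::
    "('a, 'm) monoid_scheme \<Rightarrow> 'b set \<Rightarrow> ('a \<Rightarrow> 'b \<Rightarrow> 'b) \<Rightarrow> 'a set \<Rightarrow>
     ('a set set, 'a set, 'a set set \<Rightarrow>\<^sub>0 complex) bimod" where
  "VH G M \<phi> H = span_bimod
     (L_class (factorpower G M \<phi>) (factorpower_class G M \<phi> H))
     (\<lambda>s x. VH_action G M \<phi> H s x \<one>\<^bsub>normalizer_quotient G H\<^esub>)
     (\<lambda>x g. VH_action G M \<phi> H \<one>\<^bsub>factorpower G M \<phi>\<^esub> x g)"

definition coset_bimod ::
    "('a, 'm) monoid_scheme \<Rightarrow> 'a set \<Rightarrow> ('a, 'a set, 'a set \<Rightarrow>\<^sub>0 complex) bimod" where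
  "coset_bimod G H = span_bimod (lcosets\<^bsub>G\<^esub> H)
     (\<lambda>g C. basis (g <#\<^bsub>G\<^esub> C)) (\<lambda>C k. basis (C <#>\<^bsub>G\<^esub> k))"


section \<open>Tensor product over a monoid algebra\<close>

text \<open>Elements of the monoid algebra of \<open>K\<close> are the elements of the formal span of the carrier of
  \<open>K\<close>. The following is the linear extension to the monoid algebra of a monoid action, at a fixed
  vector \<open>v\<close>, where \<open>act k\<close> is the image of \<open>v\<close> under \<open>k\<close>.\<close>

definition algebra_act ::
    "(complex, 'v, 'm) module_scheme \<Rightarrow> ('k \<Rightarrow> 'v) \<Rightarrow> ('k \<Rightarrow>\<^sub>0 complex) \<Rightarrow> 'v" where
  "algebra_act V act a =
     finsum V (\<lambda>k. Poly_Mapping.lookup a k \<odot>\<^bsub>V\<^esub> act k) (Poly_Mapping.keys a)"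

definition tensor_relators ::
    "('k, 'p) monoid_scheme \<Rightarrow> ('s, 'k, 'v, 'm) bimod_scheme \<Rightarrow> ('k, 'x, 'n) left_mod_scheme \<Rightarrow>
     ('v \<times> 'x \<Rightarrow>\<^sub>0 complex) set" where
  "tensor_relators K V X =
     {basis (v \<oplus>\<^bsub>V\<^esub> w, x) - basis (v, x) - basis (w, x) | v w x.
        v \<in> carrier V \<and> w \<in> carrier V \<and> x \<in> carrier X} \<union>
     {basis (v, x \<oplus>\<^bsub>X\<^esub> y) - basis (v, x) - basis (v, y) | v x y.
        v \<in> carrier V \<and> x \<in> carrier X \<and> y \<in> carrier X} \<union>
     {basis (c \<odot>\<^bsub>V\<^esub> v, x) - scale c (basis (v, x)) | c v x. v \<in> carrier V \<and> x \<in> carrier X} \<union>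
     {basis (v, c \<odot>\<^bsub>X\<^esub> x) - scale c (basis (v, x)) | c v x. v \<in> carrier V \<and> x \<in> carrier X} \<union>
     {basis (algebra_act V (\<lambda>k. ract V v k) a, x) - basis (v, algebra_act X (\<lambda>k. lact X k x) a) |
        a v x. a \<in> carrier (formal_span (carrier K)) \<and> v \<in> carrier V \<and> x \<in> carrier X}"

definition tensor_kernel ::
    "('k, 'p) monoid_scheme \<Rightarrow> ('s, 'k, 'v, 'm) bimod_scheme \<Rightarrow> ('k, 'x, 'n) left_mod_scheme \<Rightarrow>
     ('v \<times> 'x \<Rightarrow>\<^sub>0 complex) set" where
  "tensor_kernel K V X = \<Inter>{W. submodule W complex_ring (formal_span (carrier V \<times> carrier X)) \<and>
     tensor_relators K V X \<subseteq> W}"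

text \<open>The quotient of the formal span of all pairs by the subspace generated by the relators, with
  left action \<open>s \<cdot> (v \<otimes> x) = (s \<cdot> v) \<otimes> x\<close>. Scalars and monoid elements act on a coset by way of
  its representatives, which is independent of the choice (\<open>left_module_tensor\<close> below).\<close>

definition tensor ::
    "('k, 'p) monoid_scheme \<Rightarrow> ('s, 'k, 'v, 'm) bimod_scheme \<Rightarrow> ('k, 'x, 'n) left_mod_scheme \<Rightarrow>
     ('s, ('v \<times> 'x \<Rightarrow>\<^sub>0 complex) set) left_mod" where
  "tensor K V X =
     (let F = formal_span (carrier V \<times> carrier X); W = tensor_kernel K V X in
      \<lparr>carrier = a_rcosets\<^bsub>F\<^esub> W, mult = undefined, one = undefined,
       zero = W, add = (\<lambda>C D. C <+>\<^bsub>F\<^esub> D),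
       smult = (\<lambda>c C. \<Union>f\<in>C. W +>\<^bsub>F\<^esub> scale c f),
       lact = (\<lambda>s C. \<Union>f\<in>C. W +>\<^bsub>F\<^esub> linear_extend (\<lambda>(v, x). basis (lact V s v, x)) f)\<rparr>)"

definition simple_factorpower_module ::
    "('a, 'm) monoid_scheme \<Rightarrow> 'b set \<Rightarrow> ('a \<Rightarrow> 'b \<Rightarrow> 'b) \<Rightarrow> 'a set \<Rightarrow>
     ('a set, 'x, 'n) left_mod_scheme \<Rightarrow>
     ('a set set, (('a set set \<Rightarrow>\<^sub>0 complex) \<times> 'x \<Rightarrow>\<^sub>0 complex) set) left_mod" where
  "simple_factorpower_module G M \<phi> H X = tensor (normalizer_quotient G H) (VH G M \<phi> H) X"


section \<open>The factorpower is a monoid\<close>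

context group_action
begin

lemma factorpower_rel_equiv:
  "equiv {A. A \<noteq> {} \<and> A \<subseteq> carrier G} (factorpower_rel G E \<phi>)"
  by (rule equivI) (auto simp: factorpower_rel_def refl_on_def sym_def trans_def)

lemma image_set_mult:
  assumes "A \<subseteq> carrier G" "B \<subseteq> carrier G" "m \<in> E"
  shows "{\<phi> c m | c. c \<in> A <#> B} = {\<phi> a n | a n. a \<in> A \<and> n \<in> {\<phi> b m | b. b \<in> B}}"
proof -
  have *: "\<phi> (a \<otimes> b) m = \<phi> a (\<phi> b m)" if "a \<in> A" "b \<in> B" for a b
    using composition_rule[of m a b] that assms by blast
  show ?thesis
  proof (intro Set.set_eqI iffI)
    fix y assume "y \<in> {\<phi> c m | c. c \<in> A <#> B}"
    then obtain a b where "a \<in> A" "b \<in> B" "y = \<phi> (a \<otimes> b) m" by (auto simp: set_mult_def)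
    then show "y \<in> {\<phi> a n | a n. a \<in> A \<and> n \<in> {\<phi> b m | b. b \<in> B}}" using * by blast
  next
    fix y assume "y \<in> {\<phi> a n | a n. a \<in> A \<and> n \<in> {\<phi> b m | b. b \<in> B}}"
    then obtain a b where "a \<in> A" "b \<in> B" "y = \<phi> a (\<phi> b m)" by auto
    then have "y = \<phi> (a \<otimes> b) m" "a \<otimes> b \<in> A <#> B" using * by (auto simp: set_mult_def)
    then show "y \<in> {\<phi> c m | c. c \<in> A <#> B}" by blast
  qed
qed

lemma factorpower_rel_mult:
  assumes "(A, A') \<in> factorpower_rel G E \<phi>" "(B, B') \<in> factorpower_rel G E \<phi>"
  shows "(A <#> B, A' <#> B') \<in> factorpower_rel G E \<phi>"
proof -
  interpret G: group G using group_hom by (simp add: group_hom_def)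
  have sub: "A \<noteq> {}" "A \<subseteq> carrier G" "A' \<noteq> {}" "A' \<subseteq> carrier G"
    "B \<noteq> {}" "B \<subseteq> carrier G" "B' \<noteq> {}" "B' \<subseteq> carrier G"
    and eqA: "\<And>m. m \<in> E \<Longrightarrow> {\<phi> a m | a. a \<in> A} = {\<phi> b m | b. b \<in> A'}"
    and eqB: "\<And>m. m \<in> E \<Longrightarrow> {\<phi> a m | a. a \<in> B} = {\<phi> b m | b. b \<in> B'}"
    using assms by (auto simp: factorpower_rel_def)
  have ne: "A <#> B \<noteq> {}" "A' <#> B' \<noteq> {}" using sub by (auto simp: set_mult_def)
  have cl: "A <#> B \<subseteq> carrier G" "A' <#> B' \<subseteq> carrier G"
    using sub by (simp_all add: G.set_mult_closed)
  have "{\<phi> c m | c. c \<in> A <#> B} = {\<phi> c m | c. c \<in> A' <#> B'}" if m: "m \<in> E" for m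
  proof -
    let ?N = "{\<phi> b m | b. b \<in> B'}"
    have N: "?N \<subseteq> E" using m sub element_image by blast
    have "{\<phi> a n | a n. a \<in> A \<and> n \<in> ?N} = (\<Union>n\<in>?N. {\<phi> a n | a. a \<in> A})" by blast
    also have "\<dots> = (\<Union>n\<in>?N. {\<phi> a n | a. a \<in> A'})" using N by (intro SUP_cong refl eqA) blast
    also have "\<dots> = {\<phi> a n | a n. a \<in> A' \<and> n \<in> ?N}" by blast
    finally show ?thesis
      using image_set_mult[OF sub(2) sub(6) m] image_set_mult[OF sub(4) sub(8) m] eqB[OF m] by simp
  qed
  then show ?thesis using ne cl by (auto simp: factorpower_rel_def)
qed

lemma factorpower_class_eq_iff:
  assumes "A \<noteq> {}" "A \<subseteq> carrier G" "B \<noteq> {}" "B \<subseteq> carrier G"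
  shows "factorpower_class G E \<phi> A = factorpower_class G E \<phi> B \<longleftrightarrow>
    (\<forall>m\<in>E. {\<phi> a m | a. a \<in> A} = {\<phi> b m | b. b \<in> B})"
  unfolding factorpower_class_def
  using eq_equiv_class_iff[OF factorpower_rel_equiv, of A B] assms
  by (simp add: factorpower_rel_def)

lemma factorpower_mult_class:
  assumes "A \<noteq> {}" "A \<subseteq> carrier G" "B \<noteq> {}" "B \<subseteq> carrier G"
  shows "factorpower_class G E \<phi> A \<otimes>\<^bsub>factorpower G E \<phi>\<^esub> factorpower_class G E \<phi> B =
    factorpower_class G E \<phi> (A <#> B)"
proof -
  let ?c = "factorpower_class G E \<phi>"
  have AA: "(A, A) \<in> factorpower_rel G E \<phi>" "(B, B) \<in> factorpower_rel G E \<phi>"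
    using assms by (auto simp: factorpower_rel_def)
  have *: "?c (A' <#> B') = ?c (A <#> B)" if "A' \<in> ?c A" "B' \<in> ?c B" for A' B'
    using that factorpower_rel_mult[of A A' B B'] equiv_class_eq[OF factorpower_rel_equiv]
    by (auto simp: factorpower_class_def)
  have "A \<in> ?c A" "B \<in> ?c B" using AA by (auto simp: factorpower_class_def)
  then have "(\<Union>A'\<in>?c A. \<Union>B'\<in>?c B. ?c (A' <#> B')) = ?c (A <#> B)" using * by blast
  then show ?thesis by (simp add: factorpower_def)
qed

lemma factorpower_carrierE:
  assumes "x \<in> carrier (factorpower G E \<phi>)"
  obtains A where "A \<noteq> {}" "A \<subseteq> carrier G" "x = factorpower_class G E \<phi> A"
proof -
  have "x \<in> {A. A \<noteq> {} \<and> A \<subseteq> carrier G} // factorpower_rel G E \<phi>"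
    using assms by (simp add: factorpower_def)
  then show thesis by (rule quotientE) (auto simp: factorpower_class_def intro: that)
qed

lemma factorpower_class_closed:
  "A \<noteq> {} \<Longrightarrow> A \<subseteq> carrier G \<Longrightarrow> factorpower_class G E \<phi> A \<in> carrier (factorpower G E \<phi>)"
  by (auto simp: factorpower_def factorpower_class_def intro: quotientI)

lemma factorpower_one: "\<one>\<^bsub>factorpower G E \<phi>\<^esub> = factorpower_class G E \<phi> {\<one>}"
  by (simp add: factorpower_def)

lemma monoid_factorpower: "monoid (factorpower G E \<phi>)"
proof -
  interpret G: group G using group_hom by (simp add: group_hom_def)
  have ne: "A <#> B \<noteq> {}" if "A \<noteq> {}" "B \<noteq> {}" for A B using that by (auto simp: set_mult_def)
  have one: "{\<one>} <#> A = A" "A <#> {\<one>} = A" if "A \<subseteq> carrier G" for A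
    using that G.coset_mult_one[of A] G.lcos_mult_one[of A]
    by (simp_all add: l_coset_eq_set_mult r_coset_eq_set_mult)
  show ?thesis
  proof
    fix x y assume "x \<in> carrier (factorpower G E \<phi>)" "y \<in> carrier (factorpower G E \<phi>)"
    then show "x \<otimes>\<^bsub>factorpower G E \<phi>\<^esub> y \<in> carrier (factorpower G E \<phi>)"
      by (elim factorpower_carrierE)
        (simp add: factorpower_mult_class ne G.set_mult_closed factorpower_class_closed)
  next
    fix x y z assume "x \<in> carrier (factorpower G E \<phi>)" "y \<in> carrier (factorpower G E \<phi>)"
      "z \<in> carrier (factorpower G E \<phi>)"
    then show "x \<otimes>\<^bsub>factorpower G E \<phi>\<^esub> y \<otimes>\<^bsub>factorpower G E \<phi>\<^esub> z =
      x \<otimes>\<^bsub>factorpower G E \<phi>\<^esub> (y \<otimes>\<^bsub>factorpower G E \<phi>\<^esub> z)"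
      by (elim factorpower_carrierE)
        (simp add: factorpower_mult_class ne G.set_mult_closed G.set_mult_assoc)
  next
    fix x assume "x \<in> carrier (factorpower G E \<phi>)"
    then show "\<one>\<^bsub>factorpower G E \<phi>\<^esub> \<otimes>\<^bsub>factorpower G E \<phi>\<^esub> x = x"
      "x \<otimes>\<^bsub>factorpower G E \<phi>\<^esub> \<one>\<^bsub>factorpower G E \<phi>\<^esub> = x"
      by (elim factorpower_carrierE, simp add: factorpower_one factorpower_mult_class one)+
  next
    show "\<one>\<^bsub>factorpower G E \<phi>\<^esub> \<in> carrier (factorpower G E \<phi>)"
      by (simp add: factorpower_one factorpower_class_closed)
  qed
qed

end


section \<open>Formal spans are modules\<close>

lemma cring_complex_ring: "cring complex_ring"
proof -
  have "\<exists>y. x + y = 0" for x :: complex by (rule exI[of _ "-x"]) simp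
  then show ?thesis
    unfolding complex_ring_def
    by unfold_locales (auto simp: algebra_simps Units_def)
qed

lemma lookup_scale [simp]: "Poly_Mapping.lookup (scale c f) b = c * Poly_Mapping.lookup f b"
  by (simp add: scale_def Poly_Mapping.map.rep_eq when_def)

lemma keys_scale: "Poly_Mapping.keys (scale c f) \<subseteq> Poly_Mapping.keys f"
  by (auto simp: in_keys_iff)

lemma scale_simps:
  "scale c (f + g) = scale c f + scale c g" "scale (c + d) f = scale c f + scale d f"
  "scale (c * d) f = scale c (scale d f)" "scale 1 f = f" "scale c 0 = 0" "scale 0 f = 0"
  "scale c (f - g) = scale c f - scale c g" "scale c (- f) = - scale c f"
  by (auto intro!: poly_mapping_eqI simp: lookup_add lookup_minus algebra_simps)

lemma scale_sum: "scale c (\<Sum>i\<in>I. f i) = (\<Sum>i\<in>I. scale c (f i))"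
  by (induction I rule: infinite_finite_induct) (auto simp: scale_simps)

lemma module_formal_span: "module complex_ring (formal_span B)"
proof (rule moduleI)
  show "cring complex_ring" by (rule cring_complex_ring)
  show "abelian_group (formal_span B)"
  proof (rule abelian_groupI)
    fix x assume "x \<in> carrier (formal_span B)"
    then show "\<exists>y\<in>carrier (formal_span B). y \<oplus>\<^bsub>formal_span B\<^esub> x = \<zero>\<^bsub>formal_span B\<^esub>"
      by (intro bexI[of _ "-x"]) (auto simp: formal_span_def)
  qed (use keys_add in \<open>fastforce simp: formal_span_def algebra_simps\<close>)+
qed (use keys_scale in \<open>fastforce simp: formal_span_def complex_ring_def scale_simps\<close>)+

lemma linear_extend_superset:
  assumes "finite I" "Poly_Mapping.keys f \<subseteq> I"
  shows "linear_extend h f = (\<Sum>b\<in>I. scale (Poly_Mapping.lookup f b) (h b))"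
  unfolding linear_extend_def using assms
  by (intro sum.mono_neutral_left) (auto simp: in_keys_iff scale_simps)

lemma linear_extend_add: "linear_extend h (f + g) = linear_extend h f + linear_extend h g"
proof -
  let ?I = "Poly_Mapping.keys f \<union> Poly_Mapping.keys g"
  have "finite ?I" by simp
  with linear_extend_superset[OF this, of _ h] show ?thesis
    using keys_add[of f g] by (simp add: lookup_add scale_simps sum.distrib)
qed

lemma linear_extend_scale: "linear_extend h (scale c f) = scale c (linear_extend h f)"
  using linear_extend_superset[OF finite_keys keys_scale, of h c f]
  by (simp add: linear_extend_def scale_sum scale_simps)

lemma linear_extend_zero [simp]: "linear_extend h 0 = 0"
  by (simp add: linear_extend_def)

lemma linear_extend_sum: "linear_extend h (\<Sum>i\<in>I. f i) = (\<Sum>i\<in>I. linear_extend h (f i))"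
  by (induction I rule: infinite_finite_induct) (auto simp: linear_extend_add)

lemma linear_extend_basis [simp]: "linear_extend h (basis b) = h b"
  by (simp add: linear_extend_def scale_simps)

lemma linear_extend_cong:
  "(\<And>b. b \<in> Poly_Mapping.keys f \<Longrightarrow> h b = h' b) \<Longrightarrow> linear_extend h f = linear_extend h' f"
  by (simp add: linear_extend_def)

lemma linear_extend_comp:
  "linear_extend h (linear_extend h' f) = linear_extend (\<lambda>b. linear_extend h (h' b)) f"
  by (simp add: linear_extend_def[of h' f] linear_extend_def[of _ f] linear_extend_sum linear_extend_scale)

lemma linear_extend_id: "linear_extend basis f = f"
proof (rule poly_mapping_eqI)
  fix b
  have "Poly_Mapping.lookup (linear_extend basis f) b =
     (\<Sum>k\<in>Poly_Mapping.keys f. if b = k then Poly_Mapping.lookup f k else 0)"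
    unfolding linear_extend_def lookup_sum
    by (intro sum.cong refl) (auto simp: lookup_single when_def)
  also have "\<dots> = Poly_Mapping.lookup f b"
    by (simp add: sum.delta in_keys_iff)
  finally show "Poly_Mapping.lookup (linear_extend basis f) b = Poly_Mapping.lookup f b" .
qed

lemma keys_linear_extend:
  assumes "\<And>b. b \<in> Poly_Mapping.keys f \<Longrightarrow> Poly_Mapping.keys (h b) \<subseteq> B"
  shows "Poly_Mapping.keys (linear_extend h f) \<subseteq> B"
  unfolding linear_extend_def
  using keys_sum[of "\<lambda>b. scale (Poly_Mapping.lookup f b) (h b)" "Poly_Mapping.keys f"] assms keys_scale
  by fastforce

lemma formal_span_simps [simp]:
  "f \<in> carrier (formal_span B) \<longleftrightarrow> Poly_Mapping.keys f \<subseteq> B"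
  "f \<oplus>\<^bsub>formal_span B\<^esub> g = f + g" "\<zero>\<^bsub>formal_span B\<^esub> = 0" "c \<odot>\<^bsub>formal_span B\<^esub> f = scale c f"
  by (simp_all add: formal_span_def)

lemma module_cong:
  assumes "module R V" "carrier W = carrier V" "zero W = zero V" "add W = add V" "smult W = smult V"
  shows "module R W"
proof -
  interpret V: Module.module R V by fact
  have "abelian_group W"
  proof (rule abelian_groupI)
    fix x assume "x \<in> carrier W"
    then show "\<exists>y\<in>carrier W. y \<oplus>\<^bsub>W\<^esub> x = \<zero>\<^bsub>W\<^esub>"
      using assms(2-4) V.l_neg by (intro bexI[of _ "\<ominus>\<^bsub>V\<^esub> x"]) simp_all
  qed (use assms(2-4) in \<open>simp_all add: V.a_ac\<close>)
  with V.is_cring assms(2-5) show ?thesis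
    by (intro moduleI) (simp_all add: V.smult_l_distr V.smult_r_distr V.smult_assoc1)
qed

lemma bimodule_span_bimod:
  fixes B :: "'b set"
  assumes "monoid S" "monoid K"
    and l: "\<And>s b. \<lbrakk>s \<in> carrier S; b \<in> B\<rbrakk> \<Longrightarrow> Poly_Mapping.keys (l s b) \<subseteq> B"
    and r: "\<And>k b. \<lbrakk>k \<in> carrier K; b \<in> B\<rbrakk> \<Longrightarrow> Poly_Mapping.keys (r b k) \<subseteq> B"
    and ll: "\<And>s t b. \<lbrakk>s \<in> carrier S; t \<in> carrier S; b \<in> B\<rbrakk> \<Longrightarrow>
          linear_extend (l s) (l t b) = l (s \<otimes>\<^bsub>S\<^esub> t) b"
    and l1: "\<And>b. b \<in> B \<Longrightarrow> l \<one>\<^bsub>S\<^esub> b = basis b"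
    and rr: "\<And>j k b. \<lbrakk>j \<in> carrier K; k \<in> carrier K; b \<in> B\<rbrakk> \<Longrightarrow>
          linear_extend (\<lambda>b. r b k) (r b j) = r b (j \<otimes>\<^bsub>K\<^esub> k)"
    and r1: "\<And>b. b \<in> B \<Longrightarrow> r b \<one>\<^bsub>K\<^esub> = basis b"
    and lr: "\<And>s k b. \<lbrakk>s \<in> carrier S; k \<in> carrier K; b \<in> B\<rbrakk> \<Longrightarrow>
          linear_extend (\<lambda>b. r b k) (l s b) = linear_extend (l s) (r b k)"
  shows "bimodule S K (span_bimod B l r)"
proof -
  let ?V = "span_bimod B l r"
  have V: "module complex_ring ?V"
    by (rule module_cong[OF module_formal_span[of B]]) (simp_all add: span_bimod_def)
  have id: "linear_extend h v = v" if "\<And>b. b \<in> B \<Longrightarrow> h b = basis b" "Poly_Mapping.keys v \<subseteq> B" for h v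
    using linear_extend_cong[of v h basis] that linear_extend_id[of v] by auto
  have comp: "linear_extend h (linear_extend h' v) = linear_extend g v"
    if "\<And>b. b \<in> B \<Longrightarrow> linear_extend h (h' b) = g b" "Poly_Mapping.keys v \<subseteq> B" for h h' g v
    unfolding linear_extend_comp using that by (intro linear_extend_cong) auto
  have swap: "linear_extend h (linear_extend h' v) = linear_extend g (linear_extend g' v)"
    if "\<And>b. b \<in> B \<Longrightarrow> linear_extend h (h' b) = linear_extend g (g' b)" "Poly_Mapping.keys v \<subseteq> B"
    for h h' g g' v
    unfolding linear_extend_comp using that by (intro linear_extend_cong) auto
  have car: "v \<in> carrier ?V \<longleftrightarrow> Poly_Mapping.keys v \<subseteq> B"
    and ops: "v \<oplus>\<^bsub>?V\<^esub> w = v + w" "c \<odot>\<^bsub>?V\<^esub> v = scale c v"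
    and acts: "lact ?V s = linear_extend (l s)" "ract ?V v k = linear_extend (\<lambda>b. r b k) v"
    for v w c s k
    by (simp_all add: span_bimod_def)
  have lm: "left_module S ?V"
  proof (intro left_module.intro left_module_axioms.intro assms(1) V; unfold car ops acts)
    fix s and v :: "'b \<Rightarrow>\<^sub>0 complex"
    assume "s \<in> carrier S" "Poly_Mapping.keys v \<subseteq> B"
    then show "Poly_Mapping.keys (linear_extend (l s) v) \<subseteq> B"
      by (intro keys_linear_extend l) blast+
  next
    fix s t and v :: "'b \<Rightarrow>\<^sub>0 complex"
    assume "s \<in> carrier S" "t \<in> carrier S" "Poly_Mapping.keys v \<subseteq> B"
    then show "linear_extend (l (s \<otimes>\<^bsub>S\<^esub> t)) v = linear_extend (l s) (linear_extend (l t) v)"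
      by (intro comp[symmetric] ll)
  next
    fix v :: "'b \<Rightarrow>\<^sub>0 complex"
    assume "Poly_Mapping.keys v \<subseteq> B"
    then show "linear_extend (l \<one>\<^bsub>S\<^esub>) v = v" by (intro id l1)
  qed (rule linear_extend_add linear_extend_scale)+
  show ?thesis
  proof (intro bimodule.intro bimodule_axioms.intro assms(2) lm; unfold car ops acts)
    fix k and v :: "'b \<Rightarrow>\<^sub>0 complex"
    assume "k \<in> carrier K" "Poly_Mapping.keys v \<subseteq> B"
    then show "Poly_Mapping.keys (linear_extend (\<lambda>b. r b k) v) \<subseteq> B"
      by (intro keys_linear_extend r) blast+
  next
    fix j k and v :: "'b \<Rightarrow>\<^sub>0 complex"
    assume "j \<in> carrier K" "k \<in> carrier K" "Poly_Mapping.keys v \<subseteq> B"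
    then show "linear_extend (\<lambda>b. r b (j \<otimes>\<^bsub>K\<^esub> k)) v =
        linear_extend (\<lambda>b. r b k) (linear_extend (\<lambda>b. r b j) v)"
      by (intro comp[symmetric] rr)
  next
    fix v :: "'b \<Rightarrow>\<^sub>0 complex"
    assume "Poly_Mapping.keys v \<subseteq> B"
    then show "linear_extend (\<lambda>b. r b \<one>\<^bsub>K\<^esub>) v = v" by (intro id r1)
  next
    fix s k and v :: "'b \<Rightarrow>\<^sub>0 complex"
    assume "s \<in> carrier S" "k \<in> carrier K" "Poly_Mapping.keys v \<subseteq> B"
    then show "linear_extend (\<lambda>b. r b k) (linear_extend (l s) v) =
        linear_extend (l s) (linear_extend (\<lambda>b. r b k) v)"
      by (intro swap lr)
  qed (rule linear_extend_add linear_extend_scale)+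
qed


section \<open>The two bimodules\<close>

context group_action
begin

lemma normalizer_quotient_group:
  assumes "subgroup H G"
  shows "group (normalizer_quotient G H)"
proof -
  interpret G: group G using group_hom by (simp add: group_hom_def)
  show ?thesis
    unfolding normalizer_quotient_def
    by (rule normal.factorgroup_is_group[OF G.subgroup_in_normalizer[OF assms]])
qed

lemma normalizer_quotientE:
  assumes "subgroup H G" "k \<in> carrier (normalizer_quotient G H)"
  shows "k \<noteq> {}" "k \<subseteq> carrier G" "H <#> k = k" "k <#> H = k"
proof -
  interpret G: group G using group_hom by (simp add: group_hom_def)
  interpret N: normal H "G\<lparr>carrier := normalizer G H\<rparr>"
    by (rule G.subgroup_in_normalizer[OF assms(1)])
  interpret K: group "normalizer_quotient G H" by (rule normalizer_quotient_group[OF assms(1)])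
  have sub: "normalizer G H \<subseteq> carrier G"
    using G.normalizer_imp_subgroup[of H] subgroup.subset assms(1) by metis
  obtain n where n: "n \<in> normalizer G H" "k = H #> n"
    using assms(2) by (auto simp: normalizer_quotient_def FactGroup_def RCOSETS_def)
  have "\<one> \<in> H" using assms(1) by (rule subgroup.one_closed)
  then show "k \<noteq> {}" using n by (auto simp: r_coset_def)
  show "k \<subseteq> carrier G" using n sub subgroup.subset[OF assms(1)] G.r_coset_subset_G by blast
  show "H <#> k = k" "k <#> H = k"
    using K.l_one[OF assms(2)] K.r_one[OF assms(2)] by (simp_all add: normalizer_quotient_def FactGroup_def)
qed

lemma normalizer_quotient_simps:
  "\<one>\<^bsub>normalizer_quotient G H\<^esub> = H" "j \<otimes>\<^bsub>normalizer_quotient G H\<^esub> k = j <#> k"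
  by (simp_all add: normalizer_quotient_def FactGroup_def)

lemma bimodule_VH:
  assumes H: "subgroup H G"
  shows "bimodule (factorpower G E \<phi>) (normalizer_quotient G H) (VH G E \<phi> H)"
proof -
  let ?S = "factorpower G E \<phi>" and ?K = "normalizer_quotient G H"
  let ?c = "factorpower_class G E \<phi>"
  let ?e = "?c H"
  let ?L = "L_class ?S ?e"
  interpret S: monoid ?S by (rule monoid_factorpower)
  interpret K: group ?K by (rule normalizer_quotient_group[OF H])
  note KE = normalizer_quotientE[OF H]
  have HK: "H \<in> carrier ?K" using K.one_closed by (simp add: normalizer_quotient_simps)
  have c_closed: "?c k \<in> carrier ?S" if "k \<in> carrier ?K" for k
    using KE[OF that] by (simp add: factorpower_class_closed)
  have c_mult: "?c j \<otimes>\<^bsub>?S\<^esub> ?c k = ?c (j \<otimes>\<^bsub>?K\<^esub> k)" if "j \<in> carrier ?K" "k \<in> carrier ?K" for j k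
    using KE[OF that(1)] KE[OF that(2)] by (simp add: factorpower_mult_class normalizer_quotient_simps)
  have eS: "?e \<in> carrier ?S" by (rule c_closed[OF HK])
  have ec: "?e \<otimes>\<^bsub>?S\<^esub> ?c k = ?c k" "?c k \<otimes>\<^bsub>?S\<^esub> ?e = ?c k" if "k \<in> carrier ?K" for k
    using c_mult[OF HK that] c_mult[OF that HK] K.l_one[OF that] K.r_one[OF that]
    by (simp_all add: normalizer_quotient_simps)
  have Ll: "x \<in> ?L \<longleftrightarrow> x \<in> carrier ?S \<and> (\<exists>s\<in>carrier ?S. x = s \<otimes>\<^bsub>?S\<^esub> ?e) \<and>
      (\<exists>s\<in>carrier ?S. ?e = s \<otimes>\<^bsub>?S\<^esub> x)" (is "_ \<longleftrightarrow> ?R x") for x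
  proof
    assume "x \<in> ?L"
    then have x: "x \<in> carrier ?S"
      and eq: "{s \<otimes>\<^bsub>?S\<^esub> x | s. s \<in> carrier ?S} = {s \<otimes>\<^bsub>?S\<^esub> ?e | s. s \<in> carrier ?S}"
      by (auto simp: L_class_def)
    have "x \<in> {s \<otimes>\<^bsub>?S\<^esub> x | s. s \<in> carrier ?S}" "?e \<in> {s \<otimes>\<^bsub>?S\<^esub> ?e | s. s \<in> carrier ?S}"
      using S.l_one[OF x] S.l_one[OF eS] S.one_closed by (metis (mono_tags, lifting) mem_Collect_eq)+
    with eq have "x \<in> {s \<otimes>\<^bsub>?S\<^esub> ?e | s. s \<in> carrier ?S}" "?e \<in> {s \<otimes>\<^bsub>?S\<^esub> x | s. s \<in> carrier ?S}" by simp_all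
    with x show "?R x" by blast
  next
    assume "?R x"
    then obtain s t where st: "x \<in> carrier ?S" "s \<in> carrier ?S" "t \<in> carrier ?S"
      "x = s \<otimes>\<^bsub>?S\<^esub> ?e" "?e = t \<otimes>\<^bsub>?S\<^esub> x" by blast
    have "u \<otimes>\<^bsub>?S\<^esub> x = (u \<otimes>\<^bsub>?S\<^esub> s) \<otimes>\<^bsub>?S\<^esub> ?e" "u \<otimes>\<^bsub>?S\<^esub> ?e = (u \<otimes>\<^bsub>?S\<^esub> t) \<otimes>\<^bsub>?S\<^esub> x"
      if "u \<in> carrier ?S" for u
      using S.m_assoc[OF that st(2) eS] S.m_assoc[OF that st(3) st(1)]
      by (simp_all only: st(4)[symmetric] st(5)[symmetric])
    then have "{s \<otimes>\<^bsub>?S\<^esub> x | s. s \<in> carrier ?S} = {s \<otimes>\<^bsub>?S\<^esub> ?e | s. s \<in> carrier ?S}"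
      using st(2,3) S.m_closed by blast
    then show "x \<in> ?L" using st(1) by (simp add: L_class_def)
  qed
  have LE: thesis if "x \<in> ?L" "\<And>s t. \<lbrakk>x \<in> carrier ?S; s \<in> carrier ?S; t \<in> carrier ?S;
      x = s \<otimes>\<^bsub>?S\<^esub> ?e; ?e = t \<otimes>\<^bsub>?S\<^esub> x\<rbrakk> \<Longrightarrow> thesis" for x thesis
    using that(1)[unfolded Ll] that(2) by (elim conjE bexE)
  have LI: "x \<in> ?L" if "x \<in> carrier ?S" "s \<in> carrier ?S" "t \<in> carrier ?S"
      "x = s \<otimes>\<^bsub>?S\<^esub> ?e" "?e = t \<otimes>\<^bsub>?S\<^esub> x" for x s t
    unfolding Ll by (intro conjI bexI[of _ s] bexI[of _ t] that)
  have LS: "x \<in> carrier ?S" if "x \<in> ?L" for x using that by (rule LE)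
  have xe: "x \<otimes>\<^bsub>?S\<^esub> ?e = x" if "x \<in> ?L" for x
  proof -
    obtain s where s: "s \<in> carrier ?S" "x = s \<otimes>\<^bsub>?S\<^esub> ?e" using \<open>x \<in> ?L\<close> by (rule LE)
    then show ?thesis using S.m_assoc[OF s(1) eS eS] ec(1)[OF HK] by simp
  qed
  have xk: "x \<otimes>\<^bsub>?S\<^esub> ?c k \<in> ?L" if "x \<in> ?L" and k: "k \<in> carrier ?K" for x k
  proof -
    obtain s t where st: "x \<in> carrier ?S" "s \<in> carrier ?S" "t \<in> carrier ?S"
      "x = s \<otimes>\<^bsub>?S\<^esub> ?e" "?e = t \<otimes>\<^bsub>?S\<^esub> x" using \<open>x \<in> ?L\<close> by (rule LE)
    have ck: "?c k \<in> carrier ?S" and ik: "inv\<^bsub>?K\<^esub> k \<in> carrier ?K" "?c (inv\<^bsub>?K\<^esub> k) \<in> carrier ?S"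
      using k c_closed K.inv_closed by auto
    have "x \<otimes>\<^bsub>?S\<^esub> ?c k = (x \<otimes>\<^bsub>?S\<^esub> ?c k) \<otimes>\<^bsub>?S\<^esub> ?e"
      using S.m_assoc[OF st(1) ck eS] ec(2)[OF k] by simp
    moreover have "?e = (?c (inv\<^bsub>?K\<^esub> k) \<otimes>\<^bsub>?S\<^esub> t) \<otimes>\<^bsub>?S\<^esub> (x \<otimes>\<^bsub>?S\<^esub> ?c k)"
    proof -
      have "(?c (inv\<^bsub>?K\<^esub> k) \<otimes>\<^bsub>?S\<^esub> t) \<otimes>\<^bsub>?S\<^esub> (x \<otimes>\<^bsub>?S\<^esub> ?c k) =
        ?c (inv\<^bsub>?K\<^esub> k) \<otimes>\<^bsub>?S\<^esub> ((t \<otimes>\<^bsub>?S\<^esub> x) \<otimes>\<^bsub>?S\<^esub> ?c k)"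
        using st(1,3) ck ik S.m_assoc S.m_closed by simp
      also have "\<dots> = ?c (inv\<^bsub>?K\<^esub> k) \<otimes>\<^bsub>?S\<^esub> ?c k" using ec[OF k] by (simp add: st(5)[symmetric])
      also have "\<dots> = ?e" using c_mult[OF ik(1) k] K.l_inv[OF k] by (simp add: normalizer_quotient_simps)
      finally show ?thesis by simp
    qed
    moreover have "x \<otimes>\<^bsub>?S\<^esub> ?c k \<in> carrier ?S" "?c (inv\<^bsub>?K\<^esub> k) \<otimes>\<^bsub>?S\<^esub> t \<in> carrier ?S"
      using st(1,3) ck ik(2) by simp_all
    ultimately show ?thesis using LI by metis
  qed
  have left: "VH_action G E \<phi> H s x \<one>\<^bsub>?K\<^esub> = (if s \<otimes>\<^bsub>?S\<^esub> x \<in> ?L then basis (s \<otimes>\<^bsub>?S\<^esub> x) else 0)"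
    if "s \<in> carrier ?S" "x \<in> ?L" for s x
    using that S.m_assoc[OF that(1) LS[OF that(2)] eS] xe[OF that(2)]
    by (simp add: VH_action_def normalizer_quotient_simps)
  have right: "VH_action G E \<phi> H \<one>\<^bsub>?S\<^esub> x k = basis (x \<otimes>\<^bsub>?S\<^esub> ?c k)"
    if "k \<in> carrier ?K" "x \<in> ?L" for x k
    using that xk LS by (simp add: VH_action_def)
  have inner: "t \<otimes>\<^bsub>?S\<^esub> x \<in> ?L" if "s \<in> carrier ?S" "t \<in> carrier ?S" "x \<in> ?L" "s \<otimes>\<^bsub>?S\<^esub> t \<otimes>\<^bsub>?S\<^esub> x \<in> ?L"
    for s t x
  proof -
    obtain u where u: "u \<in> carrier ?S" "?e = u \<otimes>\<^bsub>?S\<^esub> (s \<otimes>\<^bsub>?S\<^esub> t \<otimes>\<^bsub>?S\<^esub> x)"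
      using \<open>s \<otimes>\<^bsub>?S\<^esub> t \<otimes>\<^bsub>?S\<^esub> x \<in> ?L\<close> by (rule LE)
    note x = LS[OF that(3)]
    have "u \<otimes>\<^bsub>?S\<^esub> (s \<otimes>\<^bsub>?S\<^esub> t \<otimes>\<^bsub>?S\<^esub> x) = (u \<otimes>\<^bsub>?S\<^esub> s) \<otimes>\<^bsub>?S\<^esub> (t \<otimes>\<^bsub>?S\<^esub> x)"
      using u(1) that(1,2) x by (simp add: S.m_assoc)
    moreover have "t \<otimes>\<^bsub>?S\<^esub> x = t \<otimes>\<^bsub>?S\<^esub> x \<otimes>\<^bsub>?S\<^esub> ?e"
      using S.m_assoc[OF that(2) x eS] xe[OF that(3)] by simp
    moreover have "t \<otimes>\<^bsub>?S\<^esub> x \<in> carrier ?S" "u \<otimes>\<^bsub>?S\<^esub> s \<in> carrier ?S"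
      using u(1) that(1,2) x by simp_all
    ultimately show ?thesis using LI u(2) by metis
  qed
  have outer: "s \<otimes>\<^bsub>?S\<^esub> x \<in> ?L" if "s \<in> carrier ?S" "k \<in> carrier ?K" "x \<in> ?L"
    "s \<otimes>\<^bsub>?S\<^esub> (x \<otimes>\<^bsub>?S\<^esub> ?c k) \<in> ?L" for s k x
  proof -
    have ik: "inv\<^bsub>?K\<^esub> k \<in> carrier ?K" using that by simp
    have "s \<otimes>\<^bsub>?S\<^esub> (x \<otimes>\<^bsub>?S\<^esub> ?c k) \<otimes>\<^bsub>?S\<^esub> ?c (inv\<^bsub>?K\<^esub> k) = s \<otimes>\<^bsub>?S\<^esub> (x \<otimes>\<^bsub>?S\<^esub> (?c k \<otimes>\<^bsub>?S\<^esub> ?c (inv\<^bsub>?K\<^esub> k)))"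
      using that LS c_closed ik S.m_assoc S.m_closed by simp
    also have "\<dots> = s \<otimes>\<^bsub>?S\<^esub> x"
      using c_mult[OF that(2) ik] K.r_inv[OF that(2)] xe[OF that(3)] by (simp add: normalizer_quotient_simps)
    finally show ?thesis using xk[OF that(4) ik] by simp
  qed
  show ?thesis
    unfolding VH_def
  proof (rule bimodule_span_bimod)
    show "monoid ?S" "monoid ?K" by unfold_locales
  next
    fix s x assume "s \<in> carrier ?S" "x \<in> ?L"
    then show "Poly_Mapping.keys (VH_action G E \<phi> H s x \<one>\<^bsub>?K\<^esub>) \<subseteq> ?L" by (simp add: left)
  next
    fix k x assume "k \<in> carrier ?K" "x \<in> ?L"
    then show "Poly_Mapping.keys (VH_action G E \<phi> H \<one>\<^bsub>?S\<^esub> x k) \<subseteq> ?L" by (simp add: right xk)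
  next
    fix s t x assume a: "s \<in> carrier ?S" "t \<in> carrier ?S" "x \<in> ?L"
    then show "linear_extend (\<lambda>x. VH_action G E \<phi> H s x \<one>\<^bsub>?K\<^esub>) (VH_action G E \<phi> H t x \<one>\<^bsub>?K\<^esub>) =
      VH_action G E \<phi> H (s \<otimes>\<^bsub>?S\<^esub> t) x \<one>\<^bsub>?K\<^esub>"
      using inner[OF a] by (auto simp: left LS S.m_assoc)
  next
    fix x assume "x \<in> ?L"
    then show "VH_action G E \<phi> H \<one>\<^bsub>?S\<^esub> x \<one>\<^bsub>?K\<^esub> = basis x" by (simp add: left LS)
  next
    fix j k x assume "j \<in> carrier ?K" "k \<in> carrier ?K" "x \<in> ?L"
    then show "linear_extend (\<lambda>x. VH_action G E \<phi> H \<one>\<^bsub>?S\<^esub> x k) (VH_action G E \<phi> H \<one>\<^bsub>?S\<^esub> x j) =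
      VH_action G E \<phi> H \<one>\<^bsub>?S\<^esub> x (j \<otimes>\<^bsub>?K\<^esub> k)"
      by (simp add: right xk LS S.m_assoc c_closed c_mult)
  next
    fix x assume "x \<in> ?L"
    then show "VH_action G E \<phi> H \<one>\<^bsub>?S\<^esub> x \<one>\<^bsub>?K\<^esub> = basis x" by (simp add: left LS)
  next
    fix s k x assume a: "s \<in> carrier ?S" "k \<in> carrier ?K" "x \<in> ?L"
    then show "linear_extend (\<lambda>x. VH_action G E \<phi> H \<one>\<^bsub>?S\<^esub> x k) (VH_action G E \<phi> H s x \<one>\<^bsub>?K\<^esub>) =
      linear_extend (\<lambda>x. VH_action G E \<phi> H s x \<one>\<^bsub>?K\<^esub>) (VH_action G E \<phi> H \<one>\<^bsub>?S\<^esub> x k)"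
      using outer[OF a] xk[of "s \<otimes>\<^bsub>?S\<^esub> x" k] by (auto simp: left right xk LS S.m_assoc c_closed)
  qed
qed

end

lemma (in group_action) bimodule_coset_bimod:
  assumes H: "subgroup H G"
  shows "bimodule G (normalizer_quotient G H) (coset_bimod G H)"
proof -
  interpret G: group G using group_hom by (simp add: group_hom_def)
  interpret K: group "normalizer_quotient G H" by (rule normalizer_quotient_group[OF H])
  note KE = normalizer_quotientE[OF H]
  have Hs: "H \<subseteq> carrier G" using H by (rule subgroup.subset)
  have HH: "H <#> H = H"
    using KE(3)[OF K.one_closed] by (simp add: normalizer_quotient_simps)
  have LE: "\<exists>a\<in>carrier G. C = {a} <#> H" if "C \<in> lcosets H" for C
    using that by (auto simp: LCOSETS_def l_coset_eq_set_mult)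
  have LC: "C \<subseteq> carrier G" if "C \<in> lcosets H" for C
    using LE[OF that] Hs G.set_mult_closed[of "{_}" H] by (metis empty_subsetI insert_subset)
  have LI: "g <# C \<in> lcosets H" if "g \<in> carrier G" and C: "C \<in> lcosets H" for g C
  proof -
    obtain a where a: "a \<in> carrier G" "C = a <# H" using C by (auto simp: LCOSETS_def)
    then have "g <# C = (g \<otimes> a) <# H" using that Hs G.lcos_m_assoc by simp
    then show ?thesis using that a by (auto simp: LCOSETS_def)
  qed
  have RI: "C <#> k \<in> lcosets H" if k: "k \<in> carrier (normalizer_quotient G H)" and C: "C \<in> lcosets H" for C k
  proof -
    obtain a where a: "a \<in> carrier G" "C = {a} <#> H" using LE[OF C] by blast
    obtain n where n: "n \<in> k" using KE[OF k] by blast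
    have nG: "n \<in> carrier G" using n KE[OF k] by blast
    have "\<exists>n'\<in>carrier G. k = H #> n'"
      using k G.normalizer_imp_subgroup[OF Hs, THEN subgroup.subset]
      by (auto simp: normalizer_quotient_def FactGroup_def RCOSETS_def)
    then have "k = H #> n" using G.repr_independence[OF _ _ H] n by metis
    moreover have "n <# H \<subseteq> k"
      using KE(4)[OF k] n by (auto simp: set_mult_def l_coset_def)
    moreover have "k \<subseteq> n <# H"
    proof
      fix x assume x: "x \<in> k"
      let ?i = "inv\<^bsub>normalizer_quotient G H\<^esub> k"
      have ik: "?i \<in> carrier (normalizer_quotient G H)" "?i <#> k = H"
        using k K.l_inv[OF k] by (simp_all add: normalizer_quotient_simps)
      obtain m where m: "m \<in> ?i" using KE[OF ik(1)] by blast
      have mG: "m \<in> carrier G" and xG: "x \<in> carrier G" using m x KE[OF ik(1)] KE[OF k] by auto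
      have "m \<otimes> n \<in> H" "m \<otimes> x \<in> H" using ik m n x by (auto simp: set_mult_def)
      then have "inv (m \<otimes> n) \<otimes> (m \<otimes> x) \<in> H"
        using H by (simp add: subgroup.m_closed subgroup.m_inv_closed)
      moreover have "inv (m \<otimes> n) \<otimes> (m \<otimes> x) = inv n \<otimes> x"
        using mG nG xG by (simp add: G.inv_mult_group G.m_assoc G.inv_solve_left')
      ultimately have "inv n \<otimes> x \<in> H" by simp
      moreover have "x = n \<otimes> (inv n \<otimes> x)" using nG xG by (simp add: G.m_assoc[symmetric])
      ultimately show "x \<in> n <# H" by (auto simp: l_coset_def)
    qed
    ultimately have "k = {n} <#> H" by (auto simp: l_coset_eq_set_mult)
    moreover have "C <#> k = {a} <#> k" using a Hs KE[OF k] by (simp add: G.set_mult_assoc)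
    moreover have "{a} <#> ({n} <#> H) = ({a} <#> {n}) <#> H"
      using a nG Hs by (simp add: G.set_mult_assoc)
    ultimately have "C <#> k = (a \<otimes> n) <# H" by (simp add: l_coset_eq_set_mult set_mult_def)
    then show ?thesis using a nG by (auto simp: LCOSETS_def)
  qed
  have LH: "C <#> H = C" if "C \<in> lcosets H" for C
    using LE[OF that] Hs HH by (auto simp: G.set_mult_assoc)
  have assoc: "{s} <#> ({t} <#> C) = {s \<otimes> t} <#> C" "{\<one>} <#> C = C"
    if "s \<in> carrier G" "t \<in> carrier G" "C \<in> lcosets H" for s t C
    using G.lcos_m_assoc[OF LC[OF that(3)] that(1,2)] G.lcos_mult_one[OF LC[OF that(3)]]
    by (simp_all add: l_coset_eq_set_mult)
  show ?thesis unfolding coset_bimod_def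
    by (rule bimodule_span_bimod)
      (use LI RI LC KE LH in \<open>auto simp: normalizer_quotient_simps assoc[OF _ _ ] assoc(2)[OF G.one_closed G.one_closed]
         l_coset_eq_set_mult G.set_mult_assoc intro: G.is_monoid K.is_monoid\<close>)
qed


section \<open>The tensor product is a left module\<close>

lemma submodule_formal_spanI:
  assumes "W \<subseteq> carrier (formal_span B)" "0 \<in> W"
    "\<And>f g. f \<in> W \<Longrightarrow> g \<in> W \<Longrightarrow> f + g \<in> W" "\<And>c f. f \<in> W \<Longrightarrow> scale c f \<in> W"
  shows "submodule W complex_ring (formal_span B)"
proof (rule module.submoduleI[OF module_formal_span])
  interpret F: Module.module complex_ring "formal_span B" by (rule module_formal_span)
  fix f assume f: "f \<in> W"
  have "scale (-1) f = - f" by (auto intro!: poly_mapping_eqI)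
  then have "- f \<in> W" "- f \<in> carrier (formal_span B)" using assms(4)[OF f, of "-1"] assms(1) by (metis, metis subsetD)
  moreover have "\<ominus>\<^bsub>formal_span B\<^esub> f = - f"
    using assms f calculation by (intro F.minus_equality) auto
  ultimately show "\<ominus>\<^bsub>formal_span B\<^esub> f \<in> W" by simp
qed (use assms in auto)

lemma submodule_formal_spanD:
  assumes "submodule W complex_ring (formal_span B)"
  shows "W \<subseteq> carrier (formal_span B)" "0 \<in> W"
    "\<And>f g. f \<in> W \<Longrightarrow> g \<in> W \<Longrightarrow> f + g \<in> W" "\<And>c f. f \<in> W \<Longrightarrow> scale c f \<in> W"
    "\<And>f g. f \<in> W \<Longrightarrow> g \<in> W \<Longrightarrow> f - g \<in> W"
proof -
  show 1: "W \<subseteq> carrier (formal_span B)" "0 \<in> W"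
    "\<And>f g. f \<in> W \<Longrightarrow> g \<in> W \<Longrightarrow> f + g \<in> W" "\<And>c f. f \<in> W \<Longrightarrow> scale c f \<in> W"
    using assms submodule.smult_closed[OF assms] subgroup.m_closed[OF submodule.axioms(1)[OF assms]]
      subgroup.one_closed[OF submodule.axioms(1)[OF assms]] subgroup.subset[OF submodule.axioms(1)[OF assms]]
    by (auto simp: complex_ring_def)
  fix f g assume "f \<in> W" "g \<in> W"
  moreover have "f - g = f + scale (-1) g" by (auto intro!: poly_mapping_eqI simp: lookup_minus lookup_add)
  ultimately show "f - g \<in> W" using 1(3)[OF _ 1(4)] by metis
qed

context
  fixes B :: "'b set" and W
  assumes W: "submodule W complex_ring (formal_span B)"
begin

lemma quot_coset: "W +>\<^bsub>formal_span B\<^esub> f = {w + f | w. w \<in> W}"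
  by (auto simp: a_r_coset_def r_coset_def)

lemma quot_coset_eq: "W +>\<^bsub>formal_span B\<^esub> f = W +>\<^bsub>formal_span B\<^esub> g \<longleftrightarrow> f - g \<in> W"
proof -
  note D = submodule_formal_spanD[OF W]
  have *: "h \<in> W +>\<^bsub>formal_span B\<^esub> f \<longleftrightarrow> h - f \<in> W" for f h
    unfolding quot_coset by (auto intro!: exI[of _ "h - f"])
  show ?thesis
  proof
    assume "W +>\<^bsub>formal_span B\<^esub> f = W +>\<^bsub>formal_span B\<^esub> g"
    then show "f - g \<in> W" using *[of f f] *[of f g] D(2) by simp
  next
    assume fg: "f - g \<in> W"
    have "h - f \<in> W \<longleftrightarrow> h - g \<in> W" for h
      using D(3)[OF _ fg, of "h - f"] D(5)[OF _ fg, of "h - g"] by auto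
    then show "W +>\<^bsub>formal_span B\<^esub> f = W +>\<^bsub>formal_span B\<^esub> g" using * by blast
  qed
qed

lemma quot_carrier: "C \<in> a_rcosets\<^bsub>formal_span B\<^esub> W \<longleftrightarrow> (\<exists>f\<in>carrier (formal_span B). C = W +>\<^bsub>formal_span B\<^esub> f)"
  by (auto simp: A_RCOSETS_def RCOSETS_def a_r_coset_def)

lemma quot_add: "(W +>\<^bsub>formal_span B\<^esub> f) <+>\<^bsub>formal_span B\<^esub> (W +>\<^bsub>formal_span B\<^esub> g) = W +>\<^bsub>formal_span B\<^esub> (f + g)"
proof -
  note D = submodule_formal_spanD[OF W]
  have "(W +>\<^bsub>formal_span B\<^esub> f) <+>\<^bsub>formal_span B\<^esub> (W +>\<^bsub>formal_span B\<^esub> g) = {w + f + (w' + g) | w w'. w \<in> W \<and> w' \<in> W}"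
    by (auto simp: set_add_def set_mult_def quot_coset)
  also have "\<dots> = {w + (f + g) | w. w \<in> W}"
  proof (intro Set.set_eqI iffI)
    fix h assume "h \<in> {w + f + (w' + g) | w w'. w \<in> W \<and> w' \<in> W}"
    then obtain w w' where w: "h = w + f + (w' + g)" "w \<in> W" "w' \<in> W" by blast
    then have "h = (w + w') + (f + g)" "w + w' \<in> W" using D by (auto simp: algebra_simps)
    then show "h \<in> {w + (f + g) | w. w \<in> W}" by blast
  next
    fix h assume "h \<in> {w + (f + g) | w. w \<in> W}"
    then obtain w where w: "h = w + f + (0 + g)" "w \<in> W" by (auto simp: algebra_simps)
    then show "h \<in> {w + f + (w' + g) | w w'. w \<in> W \<and> w' \<in> W}" using D(2) by blast
  qed
  finally show ?thesis by (simp add: quot_coset)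
qed

lemma quot_map:
  assumes "\<And>f g. T (f + g) = T f + T g" "\<And>w. w \<in> W \<Longrightarrow> T w \<in> W"
  shows "(\<Union>h\<in>W +>\<^bsub>formal_span B\<^esub> f. W +>\<^bsub>formal_span B\<^esub> T h) = W +>\<^bsub>formal_span B\<^esub> T f"
proof -
  have "W +>\<^bsub>formal_span B\<^esub> T h = W +>\<^bsub>formal_span B\<^esub> T f" if "h \<in> W +>\<^bsub>formal_span B\<^esub> f" for h
    using that assms unfolding quot_coset_eq by (auto simp: quot_coset)
  moreover have "f \<in> W +>\<^bsub>formal_span B\<^esub> f"
    using submodule_formal_spanD(2)[OF W] by (auto simp: quot_coset intro!: exI[of _ 0])
  ultimately show ?thesis by blast
qed

end

lemma submodule_tensor_kernel:
  "submodule (tensor_kernel K V X) complex_ring (formal_span (carrier V \<times> carrier X))"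
  if "tensor_relators K V X \<subseteq> carrier (formal_span (carrier V \<times> carrier X))"
  for K V X
proof -
  let ?F = "formal_span (carrier V \<times> carrier X)"
  have "submodule (carrier ?F) complex_ring ?F"
    using keys_add keys_scale by (intro submodule_formal_spanI) (auto, fastforce+)
  then have sub: "tensor_kernel K V X \<subseteq> carrier ?F"
    using that by (auto simp: tensor_kernel_def)
  show ?thesis
    by (intro submodule_formal_spanI sub) (auto simp: tensor_kernel_def dest: submodule_formal_spanD)
qed

lemma algebra_act_closed:
  assumes "module complex_ring V" "\<And>k. k \<in> Poly_Mapping.keys a \<Longrightarrow> h k \<in> carrier V"
  shows "algebra_act V h a \<in> carrier V"
proof -
  interpret V: Module.module complex_ring V by fact
  show ?thesis unfolding algebra_act_def
    by (rule V.finsum_closed) (use assms in \<open>auto simp: complex_ring_def\<close>)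
qed

lemma algebra_act_linear:
  assumes V: "module complex_ring V" and h: "\<And>k. k \<in> Poly_Mapping.keys a \<Longrightarrow> h k \<in> carrier V"
    and T: "\<And>v. v \<in> carrier V \<Longrightarrow> T v \<in> carrier V"
      "\<And>v w. \<lbrakk>v \<in> carrier V; w \<in> carrier V\<rbrakk> \<Longrightarrow> T (v \<oplus>\<^bsub>V\<^esub> w) = T v \<oplus>\<^bsub>V\<^esub> T w"
      "\<And>c v. v \<in> carrier V \<Longrightarrow> T (c \<odot>\<^bsub>V\<^esub> v) = c \<odot>\<^bsub>V\<^esub> T v"
  shows "T (algebra_act V h a) = algebra_act V (\<lambda>k. T (h k)) a"
proof -
  interpret V: Module.module complex_ring V by fact
  have U: "c \<in> carrier complex_ring" for c by (simp add: complex_ring_def)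
  have T0: "T \<zero>\<^bsub>V\<^esub> = \<zero>\<^bsub>V\<^esub>"
    using T(2)[of "\<zero>\<^bsub>V\<^esub>" "\<zero>\<^bsub>V\<^esub>"] T(1)[of "\<zero>\<^bsub>V\<^esub>"] V.add.l_cancel_one by auto
  have "T (finsum V (\<lambda>k. Poly_Mapping.lookup a k \<odot>\<^bsub>V\<^esub> h k) I) =
    finsum V (\<lambda>k. Poly_Mapping.lookup a k \<odot>\<^bsub>V\<^esub> T (h k)) I"
    if "finite I" "I \<subseteq> Poly_Mapping.keys a" for I
    using that
  proof (induction I)
    case (insert k I)
    have "(\<lambda>k. Poly_Mapping.lookup a k \<odot>\<^bsub>V\<^esub> h k) \<in> I \<rightarrow> carrier V"
      "(\<lambda>k. Poly_Mapping.lookup a k \<odot>\<^bsub>V\<^esub> T (h k)) \<in> I \<rightarrow> carrier V"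
      using insert h T U by auto
    then show ?case using insert h T U by (simp add: V.finsum_insert V.finsum_closed)
  qed (simp add: T0)
  then show ?thesis by (simp add: algebra_act_def)
qed

lemma tensor_relatorsI:
  "\<lbrakk>v \<in> carrier V; w \<in> carrier V; x \<in> carrier X\<rbrakk> \<Longrightarrow>
     basis (v \<oplus>\<^bsub>V\<^esub> w, x) - basis (v, x) - basis (w, x) \<in> tensor_relators K V X"
  "\<lbrakk>v \<in> carrier V; x \<in> carrier X; y \<in> carrier X\<rbrakk> \<Longrightarrow>
     basis (v, x \<oplus>\<^bsub>X\<^esub> y) - basis (v, x) - basis (v, y) \<in> tensor_relators K V X"
  "\<lbrakk>v \<in> carrier V; x \<in> carrier X\<rbrakk> \<Longrightarrow>
     basis (c \<odot>\<^bsub>V\<^esub> v, x) - scale c (basis (v, x)) \<in> tensor_relators K V X"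
  "\<lbrakk>v \<in> carrier V; x \<in> carrier X\<rbrakk> \<Longrightarrow>
     basis (v, c \<odot>\<^bsub>X\<^esub> x) - scale c (basis (v, x)) \<in> tensor_relators K V X"
  "\<lbrakk>Poly_Mapping.keys a \<subseteq> carrier K; v \<in> carrier V; x \<in> carrier X\<rbrakk> \<Longrightarrow>
     basis (algebra_act V (\<lambda>k. ract V v k) a, x) - basis (v, algebra_act X (\<lambda>k. lact X k x) a)
       \<in> tensor_relators K V X"
  unfolding tensor_relators_def formal_span_simps by blast+

lemma left_module_tensor:
  fixes V :: "('s, 'k, 'v, 'm) bimod_scheme" and X :: "('k, 'x, 'n) left_mod_scheme"
  assumes "bimodule S K V" "left_module K X"
  shows "left_module S (tensor K V X)"
proof -
  interpret V: bimodule S K V by fact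
  interpret X: left_module K X by fact
  let ?P = "carrier V \<times> carrier X"
  let ?F = "formal_span ?P" and ?W = "tensor_kernel K V X"
  have U: "c \<in> carrier complex_ring" for c by (simp add: complex_ring_def)
  have mV: "module complex_ring V" and mX: "module complex_ring X" by unfold_locales
  have actV: "algebra_act V (\<lambda>k. ract V v k) a \<in> carrier V"
    if "v \<in> carrier V" "Poly_Mapping.keys a \<subseteq> carrier K" for v a
    using that V.ract_closed by (intro algebra_act_closed mV) auto
  have actX: "algebra_act X (\<lambda>k. lact X k x) a \<in> carrier X"
    if "x \<in> carrier X" "Poly_Mapping.keys a \<subseteq> carrier K" for x a
    using that X.lact_closed by (intro algebra_act_closed mX) auto
  have kd: "Poly_Mapping.keys (f - g) \<subseteq> ?P" if "Poly_Mapping.keys f \<subseteq> ?P" "Poly_Mapping.keys g \<subseteq> ?P"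
    for f g :: "_ \<Rightarrow>\<^sub>0 complex"
    using that keys_diff[of f g] by blast
  have ks: "Poly_Mapping.keys (scale c f) \<subseteq> ?P" if "Poly_Mapping.keys f \<subseteq> ?P" for c f
    using that keys_scale[of c f] by blast
  have ka: "Poly_Mapping.keys (f + g) \<subseteq> ?P" if "Poly_Mapping.keys f \<subseteq> ?P" "Poly_Mapping.keys g \<subseteq> ?P"
    for f g :: "_ \<Rightarrow>\<^sub>0 complex"
    using that keys_add[of f g] by blast
  have rel: "tensor_relators K V X \<subseteq> carrier ?F"
  proof
    fix f assume "f \<in> tensor_relators K V X"
    then show "f \<in> carrier ?F"
      unfolding tensor_relators_def formal_span_simps
      by (elim UnE CollectE exE conjE; simp only:; intro kd ks; simp add: U actV actX)
  qed
  have W: "submodule ?W complex_ring ?F" by (rule submodule_tensor_kernel[OF rel])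
  note D = submodule_formal_spanD[OF W]
  have relW: "tensor_relators K V X \<subseteq> ?W" by (auto simp: tensor_kernel_def)
  define T :: "'s \<Rightarrow> ('v \<times> 'x \<Rightarrow>\<^sub>0 complex) \<Rightarrow> ('v \<times> 'x \<Rightarrow>\<^sub>0 complex)"
    where "T s = linear_extend (\<lambda>(v, x). basis (lact V s v, x))" for s
  have T_lin: "T s (f + g) = T s f + T s g" "T s (scale c f) = scale c (T s f)" for s f g c
    by (simp_all add: T_def linear_extend_add linear_extend_scale)
  have T_diff: "T s (f - g) = T s f - T s g" for s f g
    using T_lin(1)[of s "f - g" g] by (simp add: algebra_simps)
  have T_basis: "T s (basis (v, x)) = basis (lact V s v, x)" for s v x by (simp add: T_def)
  have T_closed: "Poly_Mapping.keys (T s f) \<subseteq> ?P" if "s \<in> carrier S" "Poly_Mapping.keys f \<subseteq> ?P" for s f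
    unfolding T_def using that V.lact_closed by (intro keys_linear_extend) auto
  have T_W: "T s w \<in> ?W" if s: "s \<in> carrier S" and w: "w \<in> ?W" for s w
  proof -
    let ?U = "{f \<in> carrier ?F. T s f \<in> ?W}"
    have "submodule ?U complex_ring ?F"
    proof (rule submodule_formal_spanI)
      show "0 \<in> ?U" using D(2) by (simp add: T_def)
    next
      fix f g assume "f \<in> ?U" "g \<in> ?U"
      then show "f + g \<in> ?U" using ka[of f g] D(3)[of "T s f" "T s g"] by (simp add: T_lin)
    next
      fix c f assume "f \<in> ?U"
      then show "scale c f \<in> ?U" using ks[of f c] D(4)[of "T s f" c] by (simp add: T_lin)
    qed auto
    moreover have "tensor_relators K V X \<subseteq> ?U"
    proof
      fix f assume f: "f \<in> tensor_relators K V X"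
      have *: "lact V s (algebra_act V (\<lambda>k. ract V v k) a) = algebra_act V (\<lambda>k. ract V (lact V s v) k) a"
        if "v \<in> carrier V" "Poly_Mapping.keys a \<subseteq> carrier K" for v a
      proof -
        have "lact V s (algebra_act V (\<lambda>k. ract V v k) a) = algebra_act V (\<lambda>k. lact V s (ract V v k)) a"
          using that s V.lact_closed V.lact_add V.lact_smult V.ract_closed
          by (intro algebra_act_linear mV) auto
        also have "\<dots> = algebra_act V (\<lambda>k. ract V (lact V s v) k) a"
          unfolding algebra_act_def using that s V.lact_ract V.ract_closed V.lact_closed U
          by (intro V.V.finsum_cong') auto
        finally show ?thesis .
      qed
      from f have "T s f \<in> tensor_relators K V X"
        unfolding tensor_relators_def formal_span_simps
        by (elim UnE CollectE exE conjE)
          (simp_all only: T_diff T_lin T_basis V.lact_add[OF s] V.lact_smult[OF s] *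
            tensor_relatorsI[unfolded tensor_relators_def formal_span_simps] V.lact_closed[OF s])
      with f rel relW show "f \<in> ?U" by blast
    qed
    ultimately have "?W \<subseteq> ?U" by (auto simp: tensor_kernel_def)
    with w show ?thesis by blast
  qed
  let ?M = "tensor K V X"
  define q where "q f = ?W +>\<^bsub>?F\<^esub> f" for f
  have car: "C \<in> carrier ?M \<longleftrightarrow> (\<exists>f. Poly_Mapping.keys f \<subseteq> ?P \<and> C = q f)" for C
    by (simp add: tensor_def Let_def q_def quot_carrier[OF W] Bex_def)
  have carI: "q f \<in> carrier ?M" if "Poly_Mapping.keys f \<subseteq> ?P" for f
    unfolding car by (rule exI[of _ f]) (simp add: that)
  have carE: thesis if "C \<in> carrier ?M" "\<And>f. \<lbrakk>Poly_Mapping.keys f \<subseteq> ?P; C = q f\<rbrakk> \<Longrightarrow> thesis" for C thesis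
    using that(1)[unfolded car] that(2) by (elim exE conjE)
  have add: "q f \<oplus>\<^bsub>?M\<^esub> q g = q (f + g)" for f g
    using quot_add[OF W] by (simp add: tensor_def Let_def q_def)
  have zero: "\<zero>\<^bsub>?M\<^esub> = q 0" by (simp add: tensor_def Let_def q_def quot_coset[OF W])
  have smult: "c \<odot>\<^bsub>?M\<^esub> q f = q (scale c f)" for c f
    using quot_map[OF W, of "scale c"] D(4) by (simp add: tensor_def Let_def q_def scale_simps)
  have lact: "lact ?M s (q f) = q (T s f)" if "s \<in> carrier S" for s f
    using quot_map[OF W, of "T s"] T_W[OF that] T_lin by (simp add: tensor_def Let_def q_def T_def)
  have k0: "Poly_Mapping.keys (0 :: _ \<Rightarrow>\<^sub>0 complex) \<subseteq> ?P" by simp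
  have mM: "module complex_ring ?M"
  proof (rule moduleI[OF cring_complex_ring])
    show "abelian_group ?M"
    proof (rule abelian_groupI)
      fix C assume "C \<in> carrier ?M"
      then obtain f where f: "Poly_Mapping.keys f \<subseteq> ?P" "C = q f" by (elim carE)
      then have "q (- f) \<in> carrier ?M" "q (- f) \<oplus>\<^bsub>?M\<^esub> C = \<zero>\<^bsub>?M\<^esub>"
        using carI[of "- f"] by (simp_all add: add zero)
      then show "\<exists>D\<in>carrier ?M. D \<oplus>\<^bsub>?M\<^esub> C = \<zero>\<^bsub>?M\<^esub>" by blast
    next
      show "\<zero>\<^bsub>?M\<^esub> \<in> carrier ?M" unfolding zero by (rule carI[OF k0])
    next
      fix C D assume "C \<in> carrier ?M" "D \<in> carrier ?M"
      then obtain f g where "Poly_Mapping.keys f \<subseteq> ?P" "Poly_Mapping.keys g \<subseteq> ?P" "C = q f" "D = q g"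
        by (elim carE)
      then show "C \<oplus>\<^bsub>?M\<^esub> D \<in> carrier ?M" by (simp only: add carI ka)
    next
      fix C D E assume "C \<in> carrier ?M" "D \<in> carrier ?M" "E \<in> carrier ?M"
      then obtain f g h where "C = q f" "D = q g" "E = q h" by (elim carE)
      then show "C \<oplus>\<^bsub>?M\<^esub> D \<oplus>\<^bsub>?M\<^esub> E = C \<oplus>\<^bsub>?M\<^esub> (D \<oplus>\<^bsub>?M\<^esub> E)" by (simp only: add add.assoc)
    next
      fix C D assume "C \<in> carrier ?M" "D \<in> carrier ?M"
      then obtain f g where "C = q f" "D = q g" by (elim carE)
      then show "C \<oplus>\<^bsub>?M\<^esub> D = D \<oplus>\<^bsub>?M\<^esub> C" by (simp only: add add.commute)
    next
      fix C assume "C \<in> carrier ?M"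
      then obtain f where "C = q f" by (elim carE)
      then show "\<zero>\<^bsub>?M\<^esub> \<oplus>\<^bsub>?M\<^esub> C = C" by (simp only: add zero add_0_left)
    qed
  next
    fix c C assume "C \<in> carrier ?M"
    then obtain f where "Poly_Mapping.keys f \<subseteq> ?P" "C = q f" by (elim carE)
    then show "c \<odot>\<^bsub>?M\<^esub> C \<in> carrier ?M" by (simp only: smult carI ks)
  next
    fix c d C assume "C \<in> carrier ?M"
    then obtain f where f: "C = q f" by (elim carE)
    then show "(c \<oplus>\<^bsub>complex_ring\<^esub> d) \<odot>\<^bsub>?M\<^esub> C = c \<odot>\<^bsub>?M\<^esub> C \<oplus>\<^bsub>?M\<^esub> d \<odot>\<^bsub>?M\<^esub> C"
      by (simp add: complex_ring_def add smult scale_simps(2))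
    show "(c \<otimes>\<^bsub>complex_ring\<^esub> d) \<odot>\<^bsub>?M\<^esub> C = c \<odot>\<^bsub>?M\<^esub> (d \<odot>\<^bsub>?M\<^esub> C)"
      by (simp add: f complex_ring_def smult scale_simps(3))
    show "\<one>\<^bsub>complex_ring\<^esub> \<odot>\<^bsub>?M\<^esub> C = C"
      by (simp add: f complex_ring_def smult scale_simps(4))
  next
    fix c C D assume "C \<in> carrier ?M" "D \<in> carrier ?M"
    then obtain f g where "C = q f" "D = q g" by (elim carE)
    then show "c \<odot>\<^bsub>?M\<^esub> (C \<oplus>\<^bsub>?M\<^esub> D) = c \<odot>\<^bsub>?M\<^esub> C \<oplus>\<^bsub>?M\<^esub> c \<odot>\<^bsub>?M\<^esub> D"
      by (simp only: add smult scale_simps(1))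
  qed
  show ?thesis
  proof (intro left_module.intro left_module_axioms.intro mM)
    show "monoid S" by unfold_locales
    fix s C assume s: "s \<in> carrier S" and "C \<in> carrier ?M"
    then obtain f where "Poly_Mapping.keys f \<subseteq> ?P" "C = q f" by (elim carE)
    then show "lact ?M s C \<in> carrier ?M" by (simp only: lact[OF s] carI T_closed[OF s])
  next
    fix s t C assume s: "s \<in> carrier S" and t: "t \<in> carrier S" and "C \<in> carrier ?M"
    then obtain f where f: "Poly_Mapping.keys f \<subseteq> ?P" "C = q f" by (elim carE)
    have "T (s \<otimes>\<^bsub>S\<^esub> t) f = T s (T t f)"
      unfolding T_def linear_extend_comp using f s t V.lact_mult
      by (intro linear_extend_cong) auto
    then show "lact ?M (s \<otimes>\<^bsub>S\<^esub> t) C = lact ?M s (lact ?M t C)" using f s t lact by simp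
  next
    fix C assume "C \<in> carrier ?M"
    then obtain f where f: "Poly_Mapping.keys f \<subseteq> ?P" "C = q f" by (elim carE)
    have "T \<one>\<^bsub>S\<^esub> f = linear_extend basis f"
      unfolding T_def using f V.lact_one by (intro linear_extend_cong) auto
    then show "lact ?M \<one>\<^bsub>S\<^esub> C = C" using f lact[OF V.one_closed, of f] by (simp add: linear_extend_id)
  next
    fix s C D assume s: "s \<in> carrier S" and "C \<in> carrier ?M" "D \<in> carrier ?M"
    then obtain f g where "C = q f" "D = q g" by (elim carE)
    then show "lact ?M s (C \<oplus>\<^bsub>?M\<^esub> D) = lact ?M s C \<oplus>\<^bsub>?M\<^esub> lact ?M s D"
      by (simp only: add lact[OF s] T_lin)
  next
    fix s c C assume s: "s \<in> carrier S" and "C \<in> carrier ?M"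
    then obtain f where "C = q f" by (elim carE)
    then show "lact ?M s (c \<odot>\<^bsub>?M\<^esub> C) = c \<odot>\<^bsub>?M\<^esub> lact ?M s C"
      by (simp only: smult lact[OF s] T_lin)
  qed
qed

end

theory Submission
  imports Defs
begin

text \<open>Orbit-maximality makes \<open>H\<close> the set of all \<open>g\<close> with \<open>g(m) \<in> H(m)\<close> for every \<open>m\<close>: these elements
  form a subgroup with the same orbits, since each of them permutes every finite \<open>H\<close>-orbit. If the
  class of \<open>A = AH\<close> is \<open>\<L>\<close>-equivalent to that of \<open>H\<close>, then some \<open>TA\<close> acts like \<open>H\<close>, so \<open>tA \<subseteq> H\<close> for
  \<open>t \<in> T\<close> and \<open>A = t\<inverse>H\<close>. Likewise cosets with the same class coincide. Hence
  \<open>gH \<mapsto> \<close> class of \<open>gH\<close> is a \<open>G\<close>-\<open>N\<^sub>G(H)/H\<close>-equivariant bijection from \<open>G/H\<close> onto the \<open>\<L>\<close>-class, which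
  is (a); (b) follows by functoriality of the tensor product.\<close>

section \<open>Functoriality of the tensor product\<close>

text \<open>Serves to show that an additive map \<open>f\<close> preserves zero, as
  \<open>f 0\<close> added to itself is \<open>f 0\<close>.\<close>

lemma add_idem_imp_zero:
  assumes "module complex_ring V" "v \<in> carrier V" "v \<oplus>\<^bsub>V\<^esub> v = v"
  shows "v = \<zero>\<^bsub>V\<^esub>"
proof -
  interpret V: Module.module complex_ring V by fact
  show ?thesis using assms(2,3) V.add.l_cancel_one by auto
qed

text \<open>Linearity is pushed through the sum by induction on finite subsets of the support of
  \<open>a\<close>. Unlike in \<open>algebra_act_linear\<close>, source and target may be different
  modules, even of different record types.\<close>

lemma algebra_act_hom:
  assumes V: "module complex_ring V" and W: "module complex_ring W"
    and h: "\<And>k. k \<in> Poly_Mapping.keys a \<Longrightarrow> h k \<in> carrier V"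
    and f: "\<And>v. v \<in> carrier V \<Longrightarrow> f v \<in> carrier W"
      "\<And>v w. \<lbrakk>v \<in> carrier V; w \<in> carrier V\<rbrakk> \<Longrightarrow> f (v \<oplus>\<^bsub>V\<^esub> w) = f v \<oplus>\<^bsub>W\<^esub> f w"
      "\<And>c v. v \<in> carrier V \<Longrightarrow> f (c \<odot>\<^bsub>V\<^esub> v) = c \<odot>\<^bsub>W\<^esub> f v"
  shows "f (algebra_act V h a) = algebra_act W (\<lambda>k. f (h k)) a"
proof -
  interpret V: Module.module complex_ring V by fact
  interpret W: Module.module complex_ring W by fact
  have U: "c \<in> carrier complex_ring" for c by (simp add: complex_ring_def)
  have f0: "f \<zero>\<^bsub>V\<^esub> = \<zero>\<^bsub>W\<^esub>"
    using f(1)[of "\<zero>\<^bsub>V\<^esub>"] f(2)[of "\<zero>\<^bsub>V\<^esub>" "\<zero>\<^bsub>V\<^esub>"] by (intro add_idem_imp_zero[OF W]) auto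
  have "f (finsum V (\<lambda>k. Poly_Mapping.lookup a k \<odot>\<^bsub>V\<^esub> h k) I) =
    finsum W (\<lambda>k. Poly_Mapping.lookup a k \<odot>\<^bsub>W\<^esub> f (h k)) I"
    if "finite I" "I \<subseteq> Poly_Mapping.keys a" for I
    using that
  proof (induction I)
    case (insert k I)
    have "(\<lambda>k. Poly_Mapping.lookup a k \<odot>\<^bsub>V\<^esub> h k) \<in> I \<rightarrow> carrier V"
      "(\<lambda>k. Poly_Mapping.lookup a k \<odot>\<^bsub>W\<^esub> f (h k)) \<in> I \<rightarrow> carrier W"
      using insert h f U by auto
    then show ?case using insert h f U by (simp add: V.finsum_insert W.finsum_insert V.finsum_closed)
  qed (simp add: f0)
  then show ?thesis by (simp add: algebra_act_def)
qed

text \<open>The homomorphisms of right \<open>K\<close>-modules: the structure that the relators of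
  the tensor product see.\<close>

definition right_linear ::
    "('k, 'q) monoid_scheme \<Rightarrow> ('s, 'k, 'v, 'm) bimod_scheme \<Rightarrow> ('s, 'k, 'w, 'n) bimod_scheme \<Rightarrow>
     ('v \<Rightarrow> 'w) \<Rightarrow> bool" where
  "right_linear K V W f \<longleftrightarrow> f \<in> carrier V \<rightarrow> carrier W \<and>
     (\<forall>v\<in>carrier V. \<forall>w\<in>carrier V. f (v \<oplus>\<^bsub>V\<^esub> w) = f v \<oplus>\<^bsub>W\<^esub> f w) \<and>
     (\<forall>c. \<forall>v\<in>carrier V. f (c \<odot>\<^bsub>V\<^esub> v) = c \<odot>\<^bsub>W\<^esub> f v) \<and>
     (\<forall>k\<in>carrier K. \<forall>v\<in>carrier V. f (ract V v k) = ract W (f v) k)"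

section \<open>Induced maps on formal spans of pairs\<close>

text \<open>The map \<open>f\<close> tensored with the identity, before passing to the quotient. For
  \<open>f = lact V s\<close> it is the operator by which \<open>tensor\<close> defines its left
  action.\<close>

definition tensor_map :: "('v \<Rightarrow> 'w) \<Rightarrow> ('v \<times> 'x \<Rightarrow>\<^sub>0 complex) \<Rightarrow> ('w \<times> 'x \<Rightarrow>\<^sub>0 complex)" where
  "tensor_map f = linear_extend (\<lambda>(v, x). basis (f v, x))"

lemma tensor_map_add: "tensor_map f (g + h) = tensor_map f g + tensor_map f h"
  by (simp add: tensor_map_def linear_extend_add)

lemma tensor_map_simps:
  "tensor_map f (g + h) = tensor_map f g + tensor_map f h"
  "tensor_map f (scale c g) = scale c (tensor_map f g)"
  "tensor_map f (g - h) = tensor_map f g - tensor_map f h"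
  "tensor_map f 0 = 0"
  "tensor_map f (basis (v, x)) = basis (f v, x)"
  \<comment> \<open>The rule for differences is additivity applied to
    \<open>(g - h) + h\<close>.\<close>
  using tensor_map_add[of f "g - h" h]
  by (simp_all add: tensor_map_add algebra_simps) (simp_all add: tensor_map_def linear_extend_scale)

text \<open>Meant for the square formed by an isomorphism and the left actions of one element
  \<open>s\<close>.\<close>

lemma tensor_map_comp:
  assumes "Poly_Mapping.keys h \<subseteq> A \<times> B" "\<And>v. v \<in> A \<Longrightarrow> f' (f v) = g' (g v)"
  shows "tensor_map f' (tensor_map f h) = tensor_map g' (tensor_map g h)"
  unfolding tensor_map_def linear_extend_comp using assms
  by (intro linear_extend_cong) auto

lemma tensor_map_ident:
  assumes "Poly_Mapping.keys h \<subseteq> A \<times> B" "\<And>v. v \<in> A \<Longrightarrow> f' (f v) = v"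
  shows "tensor_map f' (tensor_map f h) = h"
proof -
  have "tensor_map f' (tensor_map f h) = linear_extend basis h"
    unfolding tensor_map_def linear_extend_comp using assms by (intro linear_extend_cong) auto
  then show ?thesis by (simp add: linear_extend_id)
qed

lemma keys_tensor_map:
  assumes "Poly_Mapping.keys h \<subseteq> A \<times> B" "f \<in> A \<rightarrow> A'"
  shows "Poly_Mapping.keys (tensor_map f h) \<subseteq> A' \<times> B"
  unfolding tensor_map_def using assms by (intro keys_linear_extend) auto

section \<open>Induced maps on tensor products\<close>

text \<open>Makes the family of submodules intersected in \<open>tensor_kernel\<close> nonempty: the
  full span belongs to it.\<close>

lemma tensor_relators_subset:
  assumes V: "bimodule S K V" and X: "left_module K X"
  shows "tensor_relators K V X \<subseteq> carrier (formal_span (carrier V \<times> carrier X))"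
proof
  interpret V: bimodule S K V by fact
  interpret X: left_module K X by fact
  have mV: "module complex_ring V" and mX: "module complex_ring X" by unfold_locales
  have U: "c \<in> carrier complex_ring" for c by (simp add: complex_ring_def)
  have kd: "Poly_Mapping.keys (f - g) \<subseteq> P" if "Poly_Mapping.keys f \<subseteq> P" "Poly_Mapping.keys g \<subseteq> P"
    for f g :: "_ \<Rightarrow>\<^sub>0 complex" and P
    using that keys_diff[of f g] by blast
  have ks: "Poly_Mapping.keys (scale c f) \<subseteq> P" if "Poly_Mapping.keys f \<subseteq> P" for c f P
    using that keys_scale[of c f] by blast
  have act: "algebra_act V (\<lambda>k. ract V v k) a \<in> carrier V" "algebra_act X (\<lambda>k. lact X k x) a \<in> carrier X"
    if "v \<in> carrier V" "x \<in> carrier X" "Poly_Mapping.keys a \<subseteq> carrier K" for v x a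
    using that V.ract_closed X.lact_closed by (auto intro!: algebra_act_closed mV mX)
  fix f assume "f \<in> tensor_relators K V X"
  then show "f \<in> carrier (formal_span (carrier V \<times> carrier X))"
    unfolding tensor_relators_def formal_span_simps
    by (elim UnE CollectE exE conjE; simp only:; intro kd ks; simp add: U act)
qed

text \<open>The preimage of the kernel for \<open>W\<close> is a submodule. It contains all relators
  for \<open>V\<close>, because each is carried to a relator of the same kind, so minimality of the
  kernel for \<open>V\<close> applies.\<close>

lemma tensor_map_kernel:
  assumes V: "bimodule S K V" and W: "bimodule S K W" and X: "left_module K X"
    and f: "right_linear K V W f" and w: "w \<in> tensor_kernel K V X"
  shows "tensor_map f w \<in> tensor_kernel K W X"
proof -
  interpret V: bimodule S K V by fact
  interpret W: bimodule S K W by fact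
  have mV: "module complex_ring V" and mW: "module complex_ring W" by unfold_locales
  have f_closed: "f v \<in> carrier W" if "v \<in> carrier V" for v
    using f that by (auto simp: right_linear_def)
  have f_add: "f (v \<oplus>\<^bsub>V\<^esub> u) = f v \<oplus>\<^bsub>W\<^esub> f u" if "v \<in> carrier V" "u \<in> carrier V" for v u
    using f that by (auto simp: right_linear_def)
  have f_smult: "f (c \<odot>\<^bsub>V\<^esub> v) = c \<odot>\<^bsub>W\<^esub> f v" if "v \<in> carrier V" for c v
    using f that by (auto simp: right_linear_def)
  \<comment> \<open>The balancing relators range over the whole monoid algebra, so compatibility
    with single elements of \<open>K\<close> is first extended linearly.\<close>
  have f_act: "f (algebra_act V (\<lambda>k. ract V v k) a) = algebra_act W (\<lambda>k. ract W (f v) k) a"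
    if v: "v \<in> carrier V" and a: "Poly_Mapping.keys a \<subseteq> carrier K" for v a
  proof -
    have "f (algebra_act V (\<lambda>k. ract V v k) a) = algebra_act W (\<lambda>k. f (ract V v k)) a"
      using v a V.ract_closed f_closed f_add f_smult by (intro algebra_act_hom mV mW) auto
    also have "\<dots> = algebra_act W (\<lambda>k. ract W (f v) k) a"
      unfolding algebra_act_def using v a f f_closed W.ract_closed
      by (intro W.V.finsum_cong') (auto simp: right_linear_def complex_ring_def)
    finally show ?thesis .
  qed
  note relV = tensor_relators_subset[OF V X] and relW = tensor_relators_subset[OF W X]
  note D = submodule_formal_spanD[OF submodule_tensor_kernel[OF relW]]
  let ?F = "formal_span (carrier V \<times> carrier X)"
  let ?U = "{h \<in> carrier ?F. tensor_map f h \<in> tensor_kernel K W X}"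
  have "submodule ?U complex_ring ?F"
  proof (rule submodule_formal_spanI)
    fix g h assume "g \<in> ?U" "h \<in> ?U"
    then show "g + h \<in> ?U" using keys_add[of g h] D(3) by (auto simp: tensor_map_simps)
  next
    fix c h assume "h \<in> ?U"
    then show "scale c h \<in> ?U" using keys_scale[of c h] D(4) by (auto simp: tensor_map_simps)
  qed (use D(2) in \<open>auto simp: tensor_map_simps\<close>)
  moreover have "tensor_relators K V X \<subseteq> ?U"
  proof
    fix h assume h: "h \<in> tensor_relators K V X"
    then have "tensor_map f h \<in> tensor_relators K W X"
      unfolding tensor_relators_def formal_span_simps
      by (elim UnE CollectE exE conjE)
        (simp_all only: tensor_map_simps f_add f_smult f_act f_closed
          tensor_relatorsI[unfolded tensor_relators_def formal_span_simps])
    moreover have "h \<in> carrier ?F" using h relV by blast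
    ultimately show "h \<in> ?U" by (auto simp: tensor_kernel_def)
  qed
  ultimately have "tensor_kernel K V X \<subseteq> ?U" by (auto simp: tensor_kernel_def)
  with w show ?thesis by blast
qed

text \<open>Maps in both directions are needed to match the two tensor kernels exactly. Each law for
  the inverse holds because \<open>f\<close> sends both of its sides to the same element.\<close>

lemma right_linear_inv:
  assumes V: "bimodule S K V" and iso: "linear_iso V W f"
    and act: "\<And>k v. \<lbrakk>k \<in> carrier K; v \<in> carrier V\<rbrakk> \<Longrightarrow> f (ract V v k) = ract W (f v) k"
  shows "right_linear K V W f" "right_linear K W V (inv_into (carrier V) f)"
proof -
  interpret V: bimodule S K V by fact
  let ?g = "inv_into (carrier V) f"
  have bij: "bij_betw f (carrier V) (carrier W)"
    and add: "\<And>v w. \<lbrakk>v \<in> carrier V; w \<in> carrier V\<rbrakk> \<Longrightarrow> f (v \<oplus>\<^bsub>V\<^esub> w) = f v \<oplus>\<^bsub>W\<^esub> f w"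
    and smult: "\<And>c v. v \<in> carrier V \<Longrightarrow> f (c \<odot>\<^bsub>V\<^esub> v) = c \<odot>\<^bsub>W\<^esub> f v"
    using iso by (auto simp: linear_iso_def)
  show "right_linear K V W f"
    using bij_betwE[OF bij] add smult act by (auto simp: right_linear_def)
  have g: "?g w \<in> carrier V" "f (?g w) = w" if "w \<in> carrier W" for w
    using bij that by (auto simp: bij_betw_def inv_into_into f_inv_into_f)
  have gI: "?g w = v" if "v \<in> carrier V" "f v = w" for v w
    using bij that by (auto simp: bij_betw_def)
  show "right_linear K W V ?g"
    unfolding right_linear_def
  proof (intro conjI ballI allI)
    show "?g \<in> carrier W \<rightarrow> carrier V" using g by blast
    show "?g (v \<oplus>\<^bsub>W\<^esub> w) = ?g v \<oplus>\<^bsub>V\<^esub> ?g w" if "v \<in> carrier W" "w \<in> carrier W" for v w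
      using that g add by (intro gI) auto
    show "?g (c \<odot>\<^bsub>W\<^esub> v) = c \<odot>\<^bsub>V\<^esub> ?g v" if "v \<in> carrier W" for c v
      using that g smult by (intro gI) (auto simp: complex_ring_def intro!: V.V.smult_closed)
    show "?g (ract W v k) = ract V (?g v) k" if "k \<in> carrier K" "v \<in> carrier W" for k v
      using that g act V.ract_closed by (intro gI) auto
  qed
qed

text \<open>The induced bijection of formal spans carries one tensor kernel onto the other, so
  cosets correspond to cosets under taking images.\<close>

lemma tensor_isomorphic:
  fixes V :: "('s, 'k, 'v, 'm) bimod_scheme" and W :: "('s, 'k, 'w, 'n) bimod_scheme"
    and X :: "('k, 'x, 'p) left_mod_scheme"
  assumes V: "bimodule S K V" and W: "bimodule S K W" and X: "left_module K X"
    and VW: "bimodule_isomorphic S K V W"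
  shows "left_module_isomorphic S (tensor K V X) (tensor K W X)"
proof -
  obtain f where iso: "linear_iso V W f"
    and fl: "\<And>s v. \<lbrakk>s \<in> carrier S; v \<in> carrier V\<rbrakk> \<Longrightarrow> f (lact V s v) = lact W s (f v)"
    and fr: "\<And>k v. \<lbrakk>k \<in> carrier K; v \<in> carrier V\<rbrakk> \<Longrightarrow> f (ract V v k) = ract W (f v) k"
    using VW by (auto simp: bimodule_isomorphic_def)
  define g where "g = inv_into (carrier V) f"
  note hom = right_linear_inv[OF V iso fr, folded g_def]
  have bij: "bij_betw f (carrier V) (carrier W)" using iso by (simp add: linear_iso_def)
  have gf: "g (f v) = v" if "v \<in> carrier V" for v
    using bij that by (simp add: g_def bij_betw_def)
  have fg: "f (g w) = w" if "w \<in> carrier W" for w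
    using bij that by (auto simp: g_def bij_betw_def f_inv_into_f)
  let ?FV = "formal_span (carrier V \<times> carrier X)" and ?FW = "formal_span (carrier W \<times> carrier X)"
  let ?kV = "tensor_kernel K V X" and ?kW = "tensor_kernel K W X"
  let ?F = "tensor_map f :: _ \<Rightarrow> (_ \<times> 'x \<Rightarrow>\<^sub>0 complex)"
  let ?G = "tensor_map g :: _ \<Rightarrow> (_ \<times> 'x \<Rightarrow>\<^sub>0 complex)"
  note sV = submodule_tensor_kernel[OF tensor_relators_subset[OF V X]]
    and sW = submodule_tensor_kernel[OF tensor_relators_subset[OF W X]]
  note DV = submodule_formal_spanD[OF sV] and DW = submodule_formal_spanD[OF sW]
  have GF: "?G (?F h) = h" if "h \<in> carrier ?FV" for h
    using that gf by (intro tensor_map_ident) auto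
  have FG: "?F (?G h) = h" if "h \<in> carrier ?FW" for h
    using that fg by (intro tensor_map_ident) auto
  have F_closed: "?F h \<in> carrier ?FW" if "h \<in> carrier ?FV" for h
    using that keys_tensor_map[of h "carrier V" "carrier X" f "carrier W"] hom
    by (auto simp: right_linear_def)
  have G_closed: "?G h \<in> carrier ?FV" if "h \<in> carrier ?FW" for h
    using that keys_tensor_map[of h "carrier W" "carrier X" g "carrier V"] hom
    by (auto simp: right_linear_def)
  have FkV: "?F ` ?kV = ?kW"
  proof
    show "?F ` ?kV \<subseteq> ?kW" using tensor_map_kernel[OF V W X hom(1)] by blast
    show "?kW \<subseteq> ?F ` ?kV"
    proof
      fix w assume w: "w \<in> ?kW"
      then have "w = ?F (?G w)" "?G w \<in> ?kV" using FG DW(1) tensor_map_kernel[OF W V X hom(2)] by auto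
      then show "w \<in> ?F ` ?kV" by blast
    qed
  qed
  text \<open>The isomorphism sends a coset to its image, so compatibility with the operations, which are
    unions over representatives, needs no independence of the choice of representatives.\<close>
  have Fcoset: "?F ` (?kV +>\<^bsub>?FV\<^esub> h) = ?kW +>\<^bsub>?FW\<^esub> ?F h" for h
  proof -
    have "?F ` {w + h | w. w \<in> ?kV} = {w + ?F h | w. w \<in> ?F ` ?kV}"
      by (force simp: tensor_map_simps)
    then show ?thesis by (simp add: quot_coset[OF sV] quot_coset[OF sW] FkV)
  qed
  \<comment> \<open>Injectivity of \<open>?F\<close> is available on the span only, so cosets must
    lie inside it before their images can be compared.\<close>
  have coset_sub: "C \<subseteq> carrier ?FV" if "C \<in> a_rcosets\<^bsub>?FV\<^esub> ?kV" for C
  proof -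
    obtain h where "h \<in> carrier ?FV" "C = ?kV +>\<^bsub>?FV\<^esub> h" using \<open>C \<in> _\<close> unfolding quot_carrier[OF sV] by blast
    then show ?thesis using DV(1) keys_add unfolding quot_coset[OF sV] by fastforce
  qed
  have car: "carrier (tensor K V X) = a_rcosets\<^bsub>?FV\<^esub> ?kV" "carrier (tensor K W X) = a_rcosets\<^bsub>?FW\<^esub> ?kW"
    by (simp_all add: tensor_def Let_def)
  have inj: "inj_on ?F (carrier ?FV)" using GF by (rule inj_on_inverseI)
  have bijF: "bij_betw ((`) ?F) (carrier (tensor K V X)) (carrier (tensor K W X))"
    unfolding car bij_betw_def
  proof
    show "inj_on ((`) ?F) (a_rcosets\<^bsub>?FV\<^esub> ?kV)"
      using inj_on_image_eq_iff[OF inj] coset_sub by (intro inj_onI) blast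
    show "(`) ?F ` (a_rcosets\<^bsub>?FV\<^esub> ?kV) = a_rcosets\<^bsub>?FW\<^esub> ?kW"
    proof
      show "(`) ?F ` (a_rcosets\<^bsub>?FV\<^esub> ?kV) \<subseteq> a_rcosets\<^bsub>?FW\<^esub> ?kW"
      proof (intro image_subsetI)
        fix C assume "C \<in> a_rcosets\<^bsub>?FV\<^esub> ?kV"
        then obtain h where "h \<in> carrier ?FV" "C = ?kV +>\<^bsub>?FV\<^esub> h" unfolding quot_carrier[OF sV] by blast
        then show "?F ` C \<in> a_rcosets\<^bsub>?FW\<^esub> ?kW"
          unfolding quot_carrier[OF sW] using Fcoset F_closed by blast
      qed
      show "a_rcosets\<^bsub>?FW\<^esub> ?kW \<subseteq> (`) ?F ` (a_rcosets\<^bsub>?FV\<^esub> ?kV)"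
      proof
        fix D assume "D \<in> a_rcosets\<^bsub>?FW\<^esub> ?kW"
        then obtain h where h: "h \<in> carrier ?FW" "D = ?kW +>\<^bsub>?FW\<^esub> h" unfolding quot_carrier[OF sW] by blast
        then have "D = ?F ` (?kV +>\<^bsub>?FV\<^esub> ?G h)" unfolding Fcoset by (simp only: FG)
        moreover have "?kV +>\<^bsub>?FV\<^esub> ?G h \<in> a_rcosets\<^bsub>?FV\<^esub> ?kV"
          unfolding quot_carrier[OF sV] using G_closed[OF h(1)] by blast
        ultimately show "D \<in> (`) ?F ` (a_rcosets\<^bsub>?FV\<^esub> ?kV)" by blast
      qed
    qed
  qed
  have addF: "?F ` (C <+>\<^bsub>?FV\<^esub> D) = ?F ` C <+>\<^bsub>?FW\<^esub> ?F ` D" for C D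
    by (simp add: set_add_def set_mult_def image_UN tensor_map_simps)
  have smultF: "?F ` (\<Union>h\<in>C. ?kV +>\<^bsub>?FV\<^esub> scale c h) = (\<Union>h\<in>?F ` C. ?kW +>\<^bsub>?FW\<^esub> scale c h)" for C c
    by (simp add: image_UN Fcoset tensor_map_simps)
  have lactF: "?F ` (\<Union>h\<in>C. ?kV +>\<^bsub>?FV\<^esub> tensor_map (lact V s) h) =
      (\<Union>h\<in>?F ` C. ?kW +>\<^bsub>?FW\<^esub> tensor_map (lact W s) h)"
    if "C \<in> a_rcosets\<^bsub>?FV\<^esub> ?kV" and s: "s \<in> carrier S" for C s
  proof -
    \<comment> \<open>Left equivariance of \<open>f\<close> enters here. It holds on
      \<open>carrier V\<close>, hence the condition on the keys of \<open>h\<close>.\<close>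
    have "?F (tensor_map (lact V s) h) = tensor_map (lact W s) (?F h)" if "h \<in> C" for h
    proof (rule tensor_map_comp)
      show "Poly_Mapping.keys h \<subseteq> carrier V \<times> carrier X"
        using that coset_sub[OF \<open>C \<in> _\<close>] unfolding formal_span_simps(1)[symmetric] by blast
    qed (rule fl[OF s])
    then show ?thesis by (simp add: image_UN Fcoset)
  qed
  show ?thesis
    unfolding left_module_isomorphic_def linear_iso_def
  proof (intro exI[of _ "(`) ?F"] conjI ballI allI bijF)
    fix s C assume "s \<in> carrier S" "C \<in> carrier (tensor K V X)"
    then show "?F ` lact (tensor K V X) s C = lact (tensor K W X) s (?F ` C)"
      using lactF[of C s] by (simp add: tensor_def Let_def tensor_map_def)
  qed (simp_all add: tensor_def Let_def addF smultF)
qed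


section \<open>Restriction and bimodules on bases\<close>

lemma restrict_left_simps [simp]:
  "carrier (restrict_left \<iota> V) = carrier V" "zero (restrict_left \<iota> V) = zero V"
  "add (restrict_left \<iota> V) = add V" "smult (restrict_left \<iota> V) = smult V"
  "lact (restrict_left \<iota> V) t = lact V (\<iota> t)"
  by (simp_all add: restrict_left_def)

text \<open>The right action sits inside \<open>left_mod.more\<close>, which restriction copies;
  splitting the record exposes it.\<close>

lemma ract_restrict_left [simp]: "ract (restrict_left \<iota> V) = ract V"
  by (cases V) (simp add: restrict_left_def)

text \<open>Membership in \<open>hom\<close> only expresses compatibility with products, so
  preservation of the unit is a separate hypothesis; it yields the unit law.\<close>

lemma bimodule_restrict_left:
  assumes "monoid T" "bimodule S K V" "\<iota> \<in> hom T S" "\<iota> \<one>\<^bsub>T\<^esub> = \<one>\<^bsub>S\<^esub>"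
  shows "bimodule T K (restrict_left \<iota> V)"
proof -
  interpret V: bimodule S K V by fact
  have "module complex_ring (restrict_left \<iota> V)"
    by (rule module_cong[of _ V]) (simp_all add: V.V.module_axioms)
  with assms show ?thesis
    by (intro bimodule.intro bimodule_axioms.intro left_module.intro left_module_axioms.intro)
      (auto simp: hom_in_carrier hom_mult V.lact_closed V.lact_add V.lact_smult V.lact_mult V.lact_one
        V.ract_closed V.ract_add V.ract_smult V.ract_mult V.ract_one V.lact_ract intro: V.K.monoid_axioms)
qed

text \<open>The equation is not definitional: \<^const>\<open>finsum\<close> depends on the type of the record
  extension, which the restriction changes.\<close>

lemma tensor_restrict_left:
  assumes "bimodule S K V"
  shows "tensor K (restrict_left \<iota> V) X = restrict_left \<iota> (tensor K V X)"
proof -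
  interpret V: bimodule S K V by fact
  have mV: "module complex_ring V" by unfold_locales
  have mW: "module complex_ring (restrict_left \<iota> V)"
    by (rule module_cong[OF mV]) simp_all
  \<comment> \<open>The identity is linear from \<open>V\<close> to its restriction, so
    \<open>algebra_act_hom\<close> compares the sums across the two record types.\<close>
  have "algebra_act V (\<lambda>k. ract V v k) a = algebra_act (restrict_left \<iota> V) (\<lambda>k. ract V v k) a"
    if "v \<in> carrier V" "a \<in> carrier (formal_span (carrier K))" for v a
    using that V.ract_closed by (intro algebra_act_hom[OF mV mW, where f = "\<lambda>v. v"]) auto
  then have "tensor_relators K (restrict_left \<iota> V) X = tensor_relators K V X"
    unfolding tensor_relators_def restrict_left_simps ract_restrict_left
    by (intro arg_cong2[where f = "(\<union>)"] refl Collect_cong) metis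
  then have "tensor_kernel K (restrict_left \<iota> V) X = tensor_kernel K V X"
    by (simp add: tensor_kernel_def)
  then show ?thesis by (simp add: tensor_def restrict_left_def Let_def)
qed

text \<open>The inverse extends the inverse bijection of the bases. Record fields are treated one by
  one so that records carrying additional actions are covered.\<close>

lemma linear_iso_span:
  assumes "bij_betw p B B'"
    and "carrier V = carrier (formal_span B)" "add V = (+)" "smult V = scale"
    and "carrier W = carrier (formal_span B')" "add W = (+)" "smult W = scale"
  shows "linear_iso V W (linear_extend (\<lambda>b. basis (p b)))"
proof -
  let ?q = "inv_into B p"
  have p: "p b \<in> B'" "?q (p b) = b" if "b \<in> B" for b
    using assms(1) that by (auto simp: bij_betw_def)
  have q: "?q b \<in> B" "p (?q b) = b" if "b \<in> B'" for b
    using assms(1) that by (auto simp: bij_betw_def inv_into_into f_inv_into_f)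
  \<comment> \<open>Stated for arbitrary types because it is applied to \<open>p\<close> and
    \<open>?q\<close> in both orders.\<close>
  have id: "linear_extend (\<lambda>b. basis (h' b)) (linear_extend (\<lambda>b. basis (h b)) v) = v"
    if "Poly_Mapping.keys v \<subseteq> A" "\<And>b. b \<in> A \<Longrightarrow> h' (h b) = b"
    for A and h :: "'x \<Rightarrow> 'y" and h' v
  proof -
    have "linear_extend (\<lambda>b. basis (h' b)) (linear_extend (\<lambda>b. basis (h b)) v) = linear_extend basis v"
      unfolding linear_extend_comp using that by (intro linear_extend_cong) auto
    then show ?thesis by (simp add: linear_extend_id)
  qed
  have "bij_betw (linear_extend (\<lambda>b. basis (p b))) (carrier V) (carrier W)"
  proof (rule bij_betwI)
    show "linear_extend (\<lambda>b. basis (p b)) \<in> carrier V \<rightarrow> carrier W"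
      unfolding assms formal_span_simps Pi_iff using p by (intro ballI keys_linear_extend) auto
    show "linear_extend (\<lambda>b. basis (?q b)) \<in> carrier W \<rightarrow> carrier V"
      unfolding assms formal_span_simps Pi_iff using q by (intro ballI keys_linear_extend) auto
  qed (use assms p q in \<open>auto intro!: id\<close>)
  then show ?thesis using assms by (simp add: linear_iso_def linear_extend_add linear_extend_scale)
qed


section \<open>The \<open>\<L>\<close>-class of an orbit-maximal subgroup\<close>

text \<open>Thanks to the unit, each element lies in its own principal left ideal, hence in that of
  every L-equivalent element.\<close>

lemma L_classE:
  assumes "monoid S" "a \<in> carrier S" "b \<in> L_class S a"
  obtains s t where "b \<in> carrier S" "s \<in> carrier S" "t \<in> carrier S" "b = s \<otimes>\<^bsub>S\<^esub> a" "a = t \<otimes>\<^bsub>S\<^esub> b"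
proof -
  interpret monoid S by fact
  have b: "b \<in> carrier S"
    and eq: "{s \<otimes>\<^bsub>S\<^esub> b | s. s \<in> carrier S} = {s \<otimes>\<^bsub>S\<^esub> a | s. s \<in> carrier S}"
    using assms(3) by (auto simp: L_class_def)
  have "b \<in> {s \<otimes>\<^bsub>S\<^esub> b | s. s \<in> carrier S}" "a \<in> {s \<otimes>\<^bsub>S\<^esub> a | s. s \<in> carrier S}"
    using l_one[OF b] l_one[OF assms(2)] one_closed by (metis (mono_tags, lifting) mem_Collect_eq)+
  with eq b that show thesis by blast
qed

text \<open>As \<open>t\<close> is a left inverse of \<open>s\<close>, multiplying
  \<open>s a\<close> by \<open>t\<close> recovers \<open>a\<close>, so each principal left ideal
  contains the other.\<close>

lemma L_classI:
  assumes "monoid S" "a \<in> carrier S" "s \<in> carrier S" "t \<in> carrier S" "t \<otimes>\<^bsub>S\<^esub> s = \<one>\<^bsub>S\<^esub>"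
  shows "s \<otimes>\<^bsub>S\<^esub> a \<in> L_class S a"
proof -
  interpret monoid S by fact
  have "u \<otimes>\<^bsub>S\<^esub> (s \<otimes>\<^bsub>S\<^esub> a) = (u \<otimes>\<^bsub>S\<^esub> s) \<otimes>\<^bsub>S\<^esub> a" "u \<otimes>\<^bsub>S\<^esub> a = (u \<otimes>\<^bsub>S\<^esub> t) \<otimes>\<^bsub>S\<^esub> (s \<otimes>\<^bsub>S\<^esub> a)"
    if "u \<in> carrier S" for u
  proof -
    show "u \<otimes>\<^bsub>S\<^esub> (s \<otimes>\<^bsub>S\<^esub> a) = (u \<otimes>\<^bsub>S\<^esub> s) \<otimes>\<^bsub>S\<^esub> a" using that assms by (simp add: m_assoc)
    have "(u \<otimes>\<^bsub>S\<^esub> t) \<otimes>\<^bsub>S\<^esub> (s \<otimes>\<^bsub>S\<^esub> a) = u \<otimes>\<^bsub>S\<^esub> ((t \<otimes>\<^bsub>S\<^esub> s) \<otimes>\<^bsub>S\<^esub> a)"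
      using that assms(2-4) by (simp add: m_assoc)
    then show "u \<otimes>\<^bsub>S\<^esub> a = (u \<otimes>\<^bsub>S\<^esub> t) \<otimes>\<^bsub>S\<^esub> (s \<otimes>\<^bsub>S\<^esub> a)" using that assms by simp
  qed
  then have "{u \<otimes>\<^bsub>S\<^esub> (s \<otimes>\<^bsub>S\<^esub> a) | u. u \<in> carrier S} = {u \<otimes>\<^bsub>S\<^esub> a | u. u \<in> carrier S}"
    using assms m_closed by blast
  then show ?thesis using assms by (simp add: L_class_def)
qed

context group_action
begin

lemma factorpower_unit_hom:
  "factorpower_unit G E \<phi> \<in> hom G (factorpower G E \<phi>)"
  "factorpower_unit G E \<phi> \<one> = \<one>\<^bsub>factorpower G E \<phi>\<^esub>"
  by (auto intro!: homI simp: factorpower_unit_def factorpower_class_closed factorpower_one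
      factorpower_mult_class set_mult_def)

section \<open>Consequences of orbit-maximality\<close>

text \<open>A membership test in which the \<open>h\<close> matching \<open>g\<close> may vary with
  the point \<open>m\<close>; maximality makes this pointwise condition sufficient.\<close>

lemma orbit_maximal_memI:
  assumes "orbit_maximal G E \<phi> H" "finite E" "g \<in> carrier G"
    and "\<And>m. m \<in> E \<Longrightarrow> \<phi> g m \<in> {\<phi> h m | h. h \<in> H}"
  shows "g \<in> H"
proof -
  interpret G: group G using group_hom by (simp add: group_hom_def)
  have H: "subgroup H G" using assms(1) by (simp add: orbit_maximal_def)
  note HG = subgroup.subset[OF H]
  define orb where "orb m = {\<phi> h m | h. h \<in> H}" for m
  \<comment> \<open>The largest subset of \<open>G\<close> preserving every \<open>H\<close>-orbit;
    it remains to see that it is a subgroup orbit-equivalent to \<open>H\<close>.\<close>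
  define K where "K = {g \<in> carrier G. \<forall>m\<in>E. \<phi> g m \<in> orb m}"
  have HK: "H \<subseteq> K" using HG by (auto simp: K_def orb_def)
  have orb_subset: "orb m \<subseteq> E" if "m \<in> E" for m
    using that HG element_image by (auto simp: orb_def)
  have orb_self: "m \<in> orb m" if "m \<in> E" for m
    using that id_eq_one subgroup.one_closed[OF H] by (auto simp: orb_def) (metis restrict_apply')
  have orb_trans: "orb n \<subseteq> orb m" if "m \<in> E" "n \<in> orb m" for m n
  proof
    fix y assume "y \<in> orb n"
    with that obtain h h' where "h \<in> H" "h' \<in> H" "y = \<phi> h (\<phi> h' m)" by (auto simp: orb_def)
    then have "y = \<phi> (h \<otimes> h') m" "h \<otimes> h' \<in> H"
      using composition_rule[OF \<open>m \<in> E\<close>] HG subgroup.m_closed[OF H] by (auto simp: subset_iff)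
    then show "y \<in> orb m" by (auto simp: orb_def)
  qed
  have K_maps: "\<phi> g n \<in> orb m" if "g \<in> K" "m \<in> E" "n \<in> orb m" for g m n
  proof -
    have "n \<in> E" using orb_subset that by blast
    then show ?thesis using that orb_trans[of m n] by (auto simp: K_def)
  qed
  have K: "subgroup K G"
  proof (rule G.subgroupI)
    show "K \<subseteq> carrier G" by (auto simp: K_def)
    show "K \<noteq> {}" using HK subgroup.one_closed[OF H] by auto
  next
    fix a assume a: "a \<in> K"
    then have aG: "a \<in> carrier G" by (simp add: K_def)
    have "\<phi> (inv a) m \<in> orb m" if m: "m \<in> E" for m
    proof -
      \<comment> \<open>An injective self-map of a finite set is onto, so \<open>m\<close> has a
        preimage in its own orbit.\<close>
      have "\<phi> a ` orb m = orb m"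
        using orb_subset[OF m] finite_subset[OF _ assms(2)] inj_on_subset[OF inj_prop[OF aG]] K_maps[OF a m]
        by (intro endo_inj_surj) auto
      then obtain n where "n \<in> orb m" "m = \<phi> a n" using orb_self[OF m] by blast
      then show ?thesis using orbit_sym_aux[OF aG] orb_subset[OF m] by auto
    qed
    then show "inv a \<in> K" using aG by (simp add: K_def)
  next
    fix a b assume "a \<in> K" "b \<in> K"
    then show "a \<otimes> b \<in> K" using K_maps by (auto simp: K_def composition_rule)
  qed
  have "{\<phi> k m | k. k \<in> K} = orb m" if "m \<in> E" for m
    using that HK by (auto simp: K_def orb_def)
  then have "orbit (G\<lparr>carrier := H\<rparr>) \<phi> m = orbit (G\<lparr>carrier := K\<rparr>) \<phi> m" if "m \<in> E" for m
    using that by (simp add: orbit_def orb_def)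
  then have "orbit_equivalent G E \<phi> H K"
    unfolding orbit_equivalent_def orbits_def by (intro Collect_cong) metis
  with assms(1) K HK have "K = H" by (auto simp: orbit_maximal_def)
  moreover have "g \<in> K" using assms(3,4) by (simp add: K_def orb_def)
  ultimately show ?thesis by simp
qed

text \<open>Injectivity and surjectivity both reduce to \<open>orbit_maximal_memI\<close>: a
  suitable translate of a group element moves each point within its \<open>H\<close>-orbit and so
  lies in \<open>H\<close>.\<close>

lemma bij_betw_lcosets_L_class:
  assumes max: "orbit_maximal G E \<phi> H" and "finite E"
  shows "bij_betw (factorpower_class G E \<phi>) (lcosets H)
    (L_class (factorpower G E \<phi>) (factorpower_class G E \<phi> H))"
proof -
  interpret G: group G using group_hom by (simp add: group_hom_def)
  have H: "subgroup H G" using max by (simp add: orbit_maximal_def)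
  note HG = subgroup.subset[OF H] and mem = orbit_maximal_memI[OF max \<open>finite E\<close>]
  let ?c = "factorpower_class G E \<phi>" and ?S = "factorpower G E \<phi>"
  interpret S: monoid ?S by (rule monoid_factorpower)
  have H0: "H \<noteq> {}" "\<one> \<in> H" using subgroup.one_closed[OF H] by auto
  have e: "?c H \<in> carrier ?S" using H0 HG by (simp add: factorpower_class_closed)
  have lcos: "g <# H \<noteq> {}" "g <# H \<subseteq> carrier G" "?c (g <# H) = ?c {g} \<otimes>\<^bsub>?S\<^esub> ?c H"
    if "g \<in> carrier G" for g
    using that H0 HG by (auto simp: l_coset_eq_set_mult factorpower_mult_class) (auto simp: set_mult_def)
  show ?thesis
    unfolding bij_betw_def
  proof
    show "inj_on ?c (lcosets H)"
    proof (rule inj_onI)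
      fix C D assume CD: "C \<in> lcosets H" "D \<in> lcosets H" and eq: "?c C = ?c D"
      then obtain a b where a: "a \<in> carrier G" "C = a <# H" and b: "b \<in> carrier G" "D = b <# H"
        by (auto simp: LCOSETS_def)
      \<comment> \<open>Equality of classes provides, for each \<open>m\<close>, some
        \<open>h\<close> for which \<open>a\<close> and \<open>b \<otimes> h\<close> agree at
        \<open>m\<close>; this \<open>h\<close> depends on \<open>m\<close>.\<close>
      have "inv b \<otimes> a \<in> H"
      proof (rule mem)
        fix m assume m: "m \<in> E"
        have "{\<phi> x m | x. x \<in> C} = {\<phi> x m | x. x \<in> D}"
          using eq m factorpower_class_eq_iff[of C D] lcos a b by simp
        moreover have "a \<in> C" using G.lcos_self[OF a(1) H] a by simp
        ultimately obtain x where "x \<in> D" "\<phi> a m = \<phi> x m" by blast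
        then obtain h where h: "h \<in> H" "\<phi> a m = \<phi> (b \<otimes> h) m" using b by (auto simp: l_coset_def)
        then have "\<phi> (inv b \<otimes> a) m = \<phi> (inv b \<otimes> (b \<otimes> h)) m"
          using a b HG m by (simp add: composition_rule subset_iff)
        also have "inv b \<otimes> (b \<otimes> h) = h" using b h HG by (simp add: G.m_assoc[symmetric] subset_iff)
        finally show "\<phi> (inv b \<otimes> a) m \<in> {\<phi> h m | h. h \<in> H}" using h by blast
      qed (use a b in simp)
      then have "a \<in> b <# H" using a b by (simp add: subgroup.lcos_module_rev[OF H G.group_axioms])
      then show "C = D" using a b G.l_repr_independence[OF _ _ H] by metis
    qed
    show "?c ` (lcosets H) = L_class ?S (?c H)"
    proof (intro equalityI subsetI)
      fix x assume "x \<in> ?c ` (lcosets H)"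
      then obtain g where g: "g \<in> carrier G" "x = ?c {g} \<otimes>\<^bsub>?S\<^esub> ?c H"
        using lcos by (auto simp: LCOSETS_def)
      \<comment> \<open>The class of \<open>{g}\<close> is invertible, so \<open>L_classI\<close>
        applies.\<close>
      have "?c {inv g} \<otimes>\<^bsub>?S\<^esub> ?c {g} = \<one>\<^bsub>?S\<^esub>"
        using g by (simp add: factorpower_mult_class factorpower_one set_mult_def)
      then show "x \<in> L_class ?S (?c H)" unfolding g
        using g(1) e by (intro L_classI S.monoid_axioms) (auto simp: factorpower_class_closed)
    next
      fix x assume "x \<in> L_class ?S (?c H)"
      then obtain s t where st: "s \<in> carrier ?S" "t \<in> carrier ?S" "x = s \<otimes>\<^bsub>?S\<^esub> ?c H" "?c H = t \<otimes>\<^bsub>?S\<^esub> x"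
        using S.monoid_axioms e by (elim L_classE)
      obtain A where A: "A \<noteq> {}" "A \<subseteq> carrier G" "s = ?c A" using st(1) by (rule factorpower_carrierE)
      obtain T where T: "T \<noteq> {}" "T \<subseteq> carrier G" "t = ?c T" using st(2) by (rule factorpower_carrierE)
      obtain a where a: "a \<in> A" using A by blast
      \<comment> \<open>From here on \<open>t\<close> is a group element and hides the class of that
        name.\<close>
      obtain t where t: "t \<in> T" using T by blast
      have aG: "a \<in> carrier G" and tG: "t \<in> carrier G" using a t A T by auto
      \<comment> \<open>A representative of \<open>x\<close> saturated under right multiplication by
        \<open>H\<close>. It contains the coset of \<open>a\<close>, so it only has to be enclosed
        in a single coset.\<close>
      define B where "B = A <#> H"
      have B: "B \<noteq> {}" "B \<subseteq> carrier G" "x = ?c B"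
        using A H0 HG st(3) G.set_mult_closed
        by (auto simp: B_def factorpower_mult_class) (auto simp: set_mult_def)
      have TB: "T <#> B \<noteq> {}" "T <#> B \<subseteq> carrier G" "?c H = ?c (T <#> B)"
        using T B st(4) G.set_mult_closed[of T B]
        by (auto simp: factorpower_mult_class) (auto simp: set_mult_def)
      have tB: "t \<otimes> b \<in> H" if "b \<in> B" for b
      proof (rule mem)
        show "t \<otimes> b \<in> carrier G" using that B tG by auto
        fix m assume "m \<in> E"
        then have "{\<phi> h m | h. h \<in> H} = {\<phi> y m | y. y \<in> T <#> B}"
          using TB HG H0 factorpower_class_eq_iff[of H "T <#> B"] by simp
        moreover have "t \<otimes> b \<in> T <#> B" using that t by (auto simp: set_mult_def)
        ultimately show "\<phi> (t \<otimes> b) m \<in> {\<phi> h m | h. h \<in> H}" by blast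
      qed
      have aHB: "a <# H \<subseteq> B" using a by (auto simp: B_def l_coset_def set_mult_def)
      have "B \<subseteq> inv t <# H"
      proof
        fix b assume b: "b \<in> B"
        then have "b = inv t \<otimes> (t \<otimes> b)" using B tG by (auto simp: G.m_assoc[symmetric])
        then show "b \<in> inv t <# H" using tB[OF b] by (auto simp: l_coset_def)
      qed
      \<comment> \<open>Both cosets contain \<open>a\<close>, the smaller set being enclosed in the
        larger.\<close>
      moreover have "inv t <# H = a <# H"
        using calculation aHB G.lcos_self[OF aG H] G.l_repr_independence[OF _ _ H] tG by blast
      ultimately have "B = a <# H" using aHB by simp
      then show "x \<in> ?c ` (lcosets H)" using B(3) aG by (auto simp: LCOSETS_def)
    qed
  qed
qed

section \<open>Transport of both actions along the coset bijection\<close>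

text \<open>Group elements from the left and elements of the normalizer quotient from the right
  never leave the L-class, so the value \<open>0\<close> of \<open>VH_action\<close> does not occur
  and both actions permute the basis.\<close>

lemma VH_isomorphic_coset_bimod:
  assumes max: "orbit_maximal G E \<phi> H" and "finite E"
  shows "bimodule_isomorphic G (normalizer_quotient G H)
    (restrict_left (factorpower_unit G E \<phi>) (VH G E \<phi> H)) (coset_bimod G H)"
proof -
  interpret G: group G using group_hom by (simp add: group_hom_def)
  have H: "subgroup H G" using max by (simp add: orbit_maximal_def)
  note HG = subgroup.subset[OF H] and KE = normalizer_quotientE[OF H]
  let ?K = "normalizer_quotient G H"
  let ?c = "factorpower_class G E \<phi>" and ?S = "factorpower G E \<phi>"
  let ?L = "L_class ?S (?c H)"
  let ?V = "restrict_left (factorpower_unit G E \<phi>) (VH G E \<phi> H)" and ?W = "coset_bimod G H"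
  interpret S: monoid ?S by (rule monoid_factorpower)
  interpret K: group ?K by (rule normalizer_quotient_group[OF H])
  interpret W: bimodule G ?K ?W by (rule bimodule_coset_bimod[OF H])
  note bij = bij_betw_lcosets_L_class[OF assms]
  define p where "p = inv_into (lcosets H) ?c"
  have p_bij: "bij_betw p ?L (lcosets H)" unfolding p_def by (rule bij_betw_inv_into[OF bij])
  have pc: "p (?c C) = C" if "C \<in> lcosets H" for C
    using bij that by (simp add: p_def bij_betw_def)
  have cL: "?c C \<in> ?L" if "C \<in> lcosets H" for C using bij that by (auto simp: bij_betw_def)
  have LE: "\<exists>C\<in>lcosets H. x = ?c C" if "x \<in> ?L" for x using bij that by (auto simp: bij_betw_def)
  have cos: "C \<noteq> {}" "C \<subseteq> carrier G" if "C \<in> lcosets H" for C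
    using that H G.lcos_self[OF _ H] subgroup.lcosets_carrier[OF H G.group_axioms that]
    by (auto simp: LCOSETS_def)
  \<comment> \<open>Closure of the set of cosets under both multiplications is read off from the
    bimodule laws of \<open>?W\<close> on basis vectors.\<close>
  have bas: "basis C \<in> carrier ?W \<longleftrightarrow> C \<in> lcosets H" for C
    by (simp add: coset_bimod_def span_bimod_def)
  have lcl: "{g} <#> C \<in> lcosets H" if "g \<in> carrier G" "C \<in> lcosets H" for g C
    using W.lact_closed[OF that(1), of "basis C"] bas[of C] bas[of "g <# C"] that
    by (simp add: coset_bimod_def span_bimod_def l_coset_eq_set_mult)
  have rcl: "C <#> k \<in> lcosets H" if "k \<in> carrier ?K" "C \<in> lcosets H" for k C
    using W.ract_closed[OF that(1), of "basis C"] bas[of C] bas[of "C <#> k"] that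
    by (simp add: coset_bimod_def span_bimod_def)
  have HK: "H \<in> carrier ?K" using K.one_closed by (simp add: normalizer_quotient_simps)
  \<comment> \<open>Equal basis vectors have equal supports, so the right unit law descends to
    cosets.\<close>
  have CH: "C <#> H = C" if C: "C \<in> lcosets H" for C
    using W.ract_one[of "basis C"] bas[of C] C
    by (simp add: coset_bimod_def span_bimod_def normalizer_quotient_simps) (metis keys_single insertI1 singletonD zero_neq_one)
  \<comment> \<open>The unit of \<open>?K\<close> contributes a trailing factor \<open>?c H\<close>,
    which \<open>CH\<close> absorbs.\<close>
  have left: "VH_action G E \<phi> H (factorpower_unit G E \<phi> g) (?c C) \<one>\<^bsub>?K\<^esub> = basis (?c (g <# C))"
    if "g \<in> carrier G" "C \<in> lcosets H" for g C
    using that cos[OF that(2)] cos[OF lcl[OF that]] KE[OF HK] cL[OF lcl[OF that]] CH[OF lcl[OF that]]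
    by (simp add: VH_action_def factorpower_unit_def normalizer_quotient_simps factorpower_mult_class
        l_coset_eq_set_mult)
  have right: "VH_action G E \<phi> H \<one>\<^bsub>?S\<^esub> (?c C) k = basis (?c (C <#> k))"
    if "k \<in> carrier ?K" "C \<in> lcosets H" for k C
    using that cos[OF that(2)] KE[OF that(1)] cL[OF rcl[OF that]]
    by (simp add: VH_action_def factorpower_mult_class factorpower_class_closed)
  have "linear_iso ?V ?W (linear_extend (\<lambda>x. basis (p x)))"
    using p_bij by (rule linear_iso_span)
      (auto intro!: ext simp: VH_def coset_bimod_def span_bimod_def)
  moreover have "linear_extend (\<lambda>x. basis (p x)) (lact ?V g v) = lact ?W g (linear_extend (\<lambda>x. basis (p x)) v)"
    if "g \<in> carrier G" "v \<in> carrier ?V" for g v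
  proof -
    have "linear_extend (\<lambda>x. basis (p x)) (VH_action G E \<phi> H (factorpower_unit G E \<phi> g) x \<one>\<^bsub>?K\<^esub>) = basis (g <# p x)"
      if "x \<in> ?L" for x
      using LE[OF that] left[OF \<open>g \<in> _\<close>] lcl[OF \<open>g \<in> _\<close>] by (auto simp: pc l_coset_eq_set_mult)
    moreover have "Poly_Mapping.keys v \<subseteq> ?L" using that by (simp add: VH_def span_bimod_def)
    ultimately show ?thesis
      by (auto simp: VH_def coset_bimod_def span_bimod_def linear_extend_comp intro!: linear_extend_cong)
  qed
  moreover have "linear_extend (\<lambda>x. basis (p x)) (ract ?V v k) = ract ?W (linear_extend (\<lambda>x. basis (p x)) v) k"
    if "k \<in> carrier ?K" "v \<in> carrier ?V" for k v
  proof -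
    have "linear_extend (\<lambda>x. basis (p x)) (VH_action G E \<phi> H \<one>\<^bsub>?S\<^esub> x k) = basis (p x <#> k)"
      if "x \<in> ?L" for x
      using LE[OF that] right[OF \<open>k \<in> _\<close>] rcl[OF \<open>k \<in> _\<close>] by (auto simp: pc)
    moreover have "Poly_Mapping.keys v \<subseteq> ?L" using that by (simp add: VH_def span_bimod_def)
    ultimately show ?thesis
      by (auto simp: VH_def coset_bimod_def span_bimod_def linear_extend_comp intro!: linear_extend_cong)
  qed
  ultimately show ?thesis unfolding bimodule_isomorphic_def by blast
qed

end

section \<open>Restriction of the bimodule and of the simple modules to the group of units\<close>

theorem theorem13:
  fixes G :: "('a, 'm) monoid_scheme"
    and M :: "'b set"
    and \<phi> :: "'a \<Rightarrow> 'b \<Rightarrow> 'b"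
    and H :: "'a set"
  assumes "faithful_action G M \<phi>"
    and "finite (carrier G)"
    and "finite M"
    and "orbit_maximal G M \<phi> H"
  shows "bimodule_isomorphic G (normalizer_quotient G H)
           (restrict_left (factorpower_unit G M \<phi>) (VH G M \<phi> H)) (coset_bimod G H) \<and>
         (\<forall>X :: ('a set, 'x) left_mod. simple_left_module (normalizer_quotient G H) X \<longrightarrow>
           left_module_isomorphic G
             (restrict_left (factorpower_unit G M \<phi>) (simple_factorpower_module G M \<phi> H X))
             (tensor (normalizer_quotient G H) (coset_bimod G H) X))"
proof -
  interpret faithful_action G M \<phi> by fact
  have H: "subgroup H G" using assms(4) by (simp add: orbit_maximal_def)
  have "monoid G" using group_hom by (simp add: group_hom_def group.is_monoid)
  note V = bimodule_restrict_left[OF this bimodule_VH[OF H] factorpower_unit_hom]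
  note iso = VH_isomorphic_coset_bimod[OF assms(4,3)]
  show ?thesis
  proof (intro conjI iso allI impI)
    fix X :: "('a set, 'x) left_mod"
    assume "simple_left_module (normalizer_quotient G H) X"
    then have "left_module (normalizer_quotient G H) X" by (rule simple_left_module.axioms)
    \<comment> \<open>This isomorphism has the restriction inside the tensor product;
      \<open>tensor_restrict_left\<close> moves it outside.\<close>
    from tensor_isomorphic[OF V bimodule_coset_bimod[OF H] this iso]
    show "left_module_isomorphic G
        (restrict_left (factorpower_unit G M \<phi>) (simple_factorpower_module G M \<phi> H X))
        (tensor (normalizer_quotient G H) (coset_bimod G H) X)"
      by (simp add: simple_factorpower_module_def tensor_restrict_left[OF bimodule_VH[OF H]])
  qed
qed

end
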